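(* Let $0<\alpha<2$ and let $w(x)=(1-x^2)^{(\alpha-1)/2}$ for $x\in(-1,1)$. For every $u\in C_c(-1,1)$, extended by $0$ to $\mathbb{R}$, $$ \begin{aligned} \frac12\int_{\mathbb{R}}\!\int_{\mathbb{R}}\frac{(u(x)-u(y))^2}{|x-y|^{1+\alpha}}\,dx\,dy ={}&\frac12\int_{-1}^1\!\int_{-1}^1\left(\frac{u(x)}{w(x)}-\frac{u(y)}{w(y)}\right)^2\frac{w(x)w(y)}{|x-y|^{1+\alpha}}\,dx\,dy\\ &+\frac{B\left(\frac{1+\alpha}{2},\frac{2-\alpha}{2}\right)}{\alpha}\int_{-1}^1u^2(x)(1-x^2)^{-\alpha}\,dx\\ \ge{}&\frac{B\left(\frac{1+\alpha}{2},\frac{2-\alpha}{2}\right)}{\alpha2^\alpha}\int_{-1}^1u^2(x)\left(\frac1{x+1}+\frac1{1-x}\right)^\alpha dx. \end{aligned} $$ The constant $\frac{B\left(\frac{1+\alpha}{2},\frac{2-\alpha}{2}\right)}{\alpha2^\alpha}$ in the inequality $$ \frac12\int_{\mathbb{R}}\!\int_{\mathbb{R}}\frac{(u(x)-u(y))^2}{|x-y|^{1+\alpha}}\,dx\,dy \ge\frac{B\left(\frac{1+\alpha}{2},\frac{2-\alpha}{2}\right)}{\alpha2^\alpha}\int_{-1}^1u^2(x)\left(\frac1{x+1}+\frac1{1-x}\right)^\alpha dx,\qquad u\in C_c(-1,1), $$ may not be replaced by a bigger one, and there is no remainder term of power $\alpha-1$: there is no constant $c>0$ such that $$ \frac12\int_{\mathbb{R}}\!\int_{\mathbb{R}}\frac{(u(x)-u(y))^2}{|x-y|^{1+\alpha}}\,dx\,dy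 \ge\frac{B\left(\frac{1+\alpha}{2},\frac{2-\alpha}{2}\right)}{\alpha2^\alpha}\int_{-1}^1u^2(x)\left(\frac1{x+1}+\frac1{1-x}\right)^\alpha dx +c\int_{-1}^1u^2(x)\left(\frac1{x+1}+\frac1{1-x}\right)^{\alpha-1}dx $$ holds for all $u\in C_c(-1,1)$.
   Context: $C_c(-1,1)$ denotes the class of all continuous functions $u\colon(-1,1)\to\mathbb{R}$ with compact support in $(-1,1)$. $B$ is the Euler beta function. The double integrals take values in $[0,\infty]$. *)

theory Defs
  imports "HOL-Analysis.Analysis"
begin

text \<open>
  A function on \<open>(-1,1)\<close> with compact support is represented by its extension by \<open>0\<close> to the
  whole line; the support condition forces \<open>u x = 0\<close> outside \<open>(-1,1)\<close>.
\<close>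

definition Cc :: "(real \<Rightarrow> real) set" where
  "Cc = {u. continuous_on {-1<..<1} u \<and> compact (closure {x. u x \<noteq> 0}) \<and>
            closure {x. u x \<noteq> 0} \<subseteq> {-1<..<1}}"

definition w :: "real \<Rightarrow> real \<Rightarrow> real" where
  "w \<alpha> x = (1 - x\<^sup>2) powr ((\<alpha> - 1) / 2)"

text \<open>
  All integrals are Lebesgue integrals with values in \<open>[0,\<infinity>]\<close>. On the diagonal \<open>x = y\<close>, a null
  set, the integrands below are \<open>0\<close> because division by zero yields zero.
\<close>

definition energy :: "real \<Rightarrow> (real \<Rightarrow> real) \<Rightarrow> ennreal" where
  "energy \<alpha> u = ennreal (1 / 2) *
     (\<integral>\<^sup>+ y. (\<integral>\<^sup>+ x. ennreal ((u x - u y)\<^sup>2 / \<bar>x - y\<bar> powr (1 + \<alpha>)) \<partial>lborel) \<partial>lborel)"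

definition weighted_energy :: "real \<Rightarrow> (real \<Rightarrow> real) \<Rightarrow> ennreal" where
  "weighted_energy \<alpha> u = ennreal (1 / 2) *
     (\<integral>\<^sup>+ y\<in>{-1<..<1}. (\<integral>\<^sup>+ x\<in>{-1<..<1}.
        ennreal ((u x / w \<alpha> x - u y / w \<alpha> y)\<^sup>2 * (w \<alpha> x * w \<alpha> y / \<bar>x - y\<bar> powr (1 + \<alpha>)))
      \<partial>lborel) \<partial>lborel)"

definition hardy_integral :: "real \<Rightarrow> (real \<Rightarrow> real) \<Rightarrow> ennreal" where
  "hardy_integral p u =
     (\<integral>\<^sup>+ x\<in>{-1<..<1}. ennreal ((u x)\<^sup>2 * (1 / (x + 1) + 1 / (1 - x)) powr p) \<partial>lborel)"

end

theory Submission
  imports Defs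
begin

text \<open>
  The substitution \<open>x = tanh a\<close> makes the right-hand side of the identity translation invariant. Since
  \<open>tanh a - tanh b = sinh (a - b) / (cosh a * cosh b)\<close> and \<open>1 - tanh\<^sup>2 a = 1 / cosh\<^sup>2 a\<close>, the measure
  \<open>w(x) w(y) / \<bar>x - y\<bar> powr (1 + \<alpha>) dx dy\<close> becomes \<open>k (a - b) da db\<close> with
  \<open>k r = \<bar>sinh r\<bar> powr (- 1 - \<alpha>)\<close>. Writing \<open>\<psi> a = u (tanh a) / w (tanh a)\<close>, the weighted energy is
  half the double integral of \<open>(\<psi> a - \<psi> b)\<^sup>2 k (a - b)\<close>, and the Hardy term, the integral of
  \<open>u\<^sup>2 (1 - x\<^sup>2) powr (- \<alpha>)\<close>, is simply the integral of \<open>\<psi>\<^sup>2\<close>.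

  The identity is the ground state representation for \<open>w\<close>. Expanding squares, the energy density
  of \<open>u\<close> differs from that of \<open>\<psi>\<close> by a diagonal term
  \<open>\<psi>\<^sup>2 a * ((cosh b / cosh a) powr (\<alpha> - 1) - 1) * k (a - b)\<close> and its mirror image. This is only
  conditionally integrable, so the kernel is cut off at \<open>\<bar>a - b\<bar> < \<epsilon>\<close>; this cutoff, symmetric in the
  new variable rather than in \<open>x - y\<close>, is what makes the integrals explicit. With \<open>T = coth \<epsilon>\<close> and
  \<open>x = tanh a\<close>, the function \<open>(coth r + x) powr \<alpha>\<close> is an antiderivative up to a constant factor, and
  the cut integral over \<open>b\<close> of \<open>(cosh b / cosh a) powr (\<alpha> - 1) k (a - b)\<close> is
  \<open>((T + x) powr \<alpha> + (T - x) powr \<alpha> - (1 + x) powr \<alpha> - (1 - x) powr \<alpha>) / \<alpha>\<close>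
  (\<open>nn_integral_cosh_ratio\<close>). The last two terms cancel exactly against the interaction of
  \<open>(-1,1)\<close> with its complement. What remains is compared with the cut mass of \<open>k\<close>: the difference tends to
  \<open>Beta ((1 + \<alpha>) / 2) ((2 - \<alpha>) / 2) / \<alpha>\<close> uniformly in \<open>x\<close> (\<open>cut_kernel_asymptotics\<close>), because second
  differences of \<open>t powr \<alpha>\<close> vanish at infinity for \<open>\<alpha> < 2\<close>, and because an integration by parts
  turns the cut mass of \<open>k\<close> into an Euler integral. Letting \<open>\<epsilon>\<close> tend to \<open>0\<close> by monotone convergence
  gives the identity, with both sides possibly infinite (\<open>ground_state_representation\<close>).

  The inequality follows by dropping the weighted energy, because
  \<open>1 / (x + 1) + 1 / (1 - x) = 2 / (1 - x\<^sup>2)\<close>. A remainder of power \<open>\<alpha> - 1\<close> would have to be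
  controlled by the weighted energy alone, whereas for \<open>u = w \<phi>\<close> it is \<open>2 powr (\<alpha> - 1)\<close> times the integral of \<open>\<phi>\<^sup>2\<close>. Tents of
  width \<open>L\<close> in the variable \<open>a\<close> refute this: there the weighted energy is at most
  \<open>2 / L\<close> times the second moment of \<open>k\<close>, while \<open>\<phi>\<^sup>2\<close> keeps a fixed amount of mass. A constant
  larger than the given one would yield such a remainder, since \<open>1 / (x + 1) + 1 / (1 - x) \<ge> 2\<close>.
\<close>

section \<open>Hyperbolic coordinates on the interval\<close>

lemma one_minus_tanh_sq: "1 - (tanh a)\<^sup>2 = 1 / (cosh (a::real))\<^sup>2"
proof -
  have "(cosh a)\<^sup>2 \<noteq> 0" by simp
  thus ?thesis unfolding tanh_def power_divide
    by (simp add: field_simps cosh_square_eq[of a] del: power_eq_0_iff)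
qed

lemma tanh_diff_sinh: "tanh a - tanh b = sinh (a - b) / (cosh a * cosh (b::real))"
  by (simp add: tanh_def sinh_diff field_simps)

lemma borel_measurable_hyperbolic [measurable]:
  "(tanh :: real \<Rightarrow> real) \<in> borel_measurable borel"
  "(sinh :: real \<Rightarrow> real) \<in> borel_measurable borel"
  "(cosh :: real \<Rightarrow> real) \<in> borel_measurable borel"
  by (auto intro!: borel_measurable_continuous_onI continuous_intros)

lemma tanh_sq_le_1: "(tanh (a::real))\<^sup>2 \<le> 1"
  using one_minus_tanh_sq[of a] by (smt (verit) divide_nonneg_nonneg zero_le_power2)

text \<open>
  Change of variables for arbitrary measurable \<open>f\<close> with values in \<open>[0,\<infinity>]\<close>; this generality is needed
  because inner integrals of a double integral may be infinite. Checking it on indicator functions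
  over compact intervals suffices, since the two sides are integrals with respect to two measures.
\<close>

lemma nn_integral_tanh:
  fixes f :: "real \<Rightarrow> ennreal"
  assumes [measurable]: "f \<in> borel_measurable borel"
  shows "(\<integral>\<^sup>+x\<in>{-1<..<1}. f x \<partial>lborel) = (\<integral>\<^sup>+a. f (tanh a) * ennreal (1 / (cosh a)\<^sup>2) \<partial>lborel)"
proof -
  define g where "g = (\<lambda>a::real. 1 / (cosh a)\<^sup>2)"
  have g: "g a \<ge> 0" for a by (simp add: g_def)
  have [measurable]: "g \<in> borel_measurable borel" unfolding g_def by measurable
  have "emeasure (density lborel (indicator {-1<..<1})) A = emeasure (distr (density lborel g) borel tanh) A"
    if A[measurable]: "A \<in> sets borel" for A
  proof -
    have 1: "(\<integral>\<^sup>+x. indicator A x * indicator {tanh (-real n)..tanh (real n)} x \<partial>lborel)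
        = (\<integral>\<^sup>+a. indicator A (tanh a) * ennreal (g a) * indicator {-real n..real n} a \<partial>lborel)" (is "?a n = ?b n") for n
    proof -
      have "(\<integral>\<^sup>+x. ennreal (indicator A x * indicator {tanh (-real n)..tanh (real n)} x) \<partial>lborel)
        = (\<integral>\<^sup>+a. ennreal (indicator A (tanh a) * g a * indicator {-real n..real n} a) \<partial>lborel)"
        by (rule nn_integral_substitution)
           (auto simp: g_def one_minus_tanh_sq[symmetric] tanh_sq_le_1 set_borel_measurable_def
             intro!: derivative_eq_intros continuous_intros)
      thus ?thesis by (simp add: ennreal_mult' g mult.assoc ennreal_indicator)
    qed
    have un: "(\<Union>n. {tanh (-real n)..tanh (real n)}) = {-1<..<1}"
    proof (intro equalityI subsetI)
      fix x :: real assume x: "x \<in> {-1<..<1}"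
      have "eventually (\<lambda>n. x \<le> tanh (real n)) sequentially"
        using order_tendstoD(1)[OF filterlim_compose[OF tanh_real_at_top filterlim_real_sequentially], of x] x
        by (simp add: eventually_mono[OF _ less_imp_le])
      moreover have "eventually (\<lambda>n. -x \<le> tanh (real n)) sequentially"
        using order_tendstoD(1)[OF filterlim_compose[OF tanh_real_at_top filterlim_real_sequentially], of "-x"] x
        by (simp add: eventually_mono[OF _ less_imp_le])
      ultimately have "eventually (\<lambda>n. x \<in> {tanh (-real n)..tanh (real n)}) sequentially"
        by eventually_elim auto
      thus "x \<in> (\<Union>n. {tanh (-real n)..tanh (real n)})"
        by (auto dest: eventually_happens)
    next
      fix x assume "x \<in> (\<Union>n. {tanh (-real n)..tanh (real n)})"
      then obtain n where "tanh (-real n) \<le> x" "x \<le> tanh (real n)" by auto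
      thus "x \<in> {-1<..<1}" using tanh_real_lt_1[of "real n"] by auto
    qed
    have un2: "(\<Union>n. {-real n..real n}) = UNIV"
    proof (intro equalityI subsetI)
      fix x :: real
      obtain n where "\<bar>x\<bar> \<le> real n" using real_arch_simple by blast
      thus "x \<in> (\<Union>n. {-real n..real n})" by (intro UN_I[of n]) auto
    qed auto
    have i1: "incseq (\<lambda>n. {tanh (-real n)..tanh (real n)})"
    proof (rule monoI)
      fix m n :: nat assume "m \<le> n"
      hence "tanh (-real n) \<le> tanh (-real m)" "tanh (real m) \<le> tanh (real n)"
        unfolding tanh_real_le_iff by simp_all
      thus "{tanh (-real m)..tanh (real m)} \<subseteq> {tanh (-real n)..tanh (real n)}"
        unfolding atLeastatMost_subset_iff by blast
    qed
    have i2: "incseq (\<lambda>n. {-real n..real n})"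
      by (auto simp: incseq_def)
    have r1: "range (\<lambda>n. {tanh (-real n)..tanh (real n)}) \<subseteq> sets (density lborel (indicator A))"
      by (rule image_subsetI) (simp del: tanh_minus)
    have r2: "range (\<lambda>n. {-real n..real n}) \<subseteq> sets (density lborel (\<lambda>a. indicator A (tanh a) * ennreal (g a)))"
      by (rule image_subsetI) simp
    have "emeasure (density lborel (indicator {-1<..<1})) A
       = emeasure (density lborel (indicator A)) {-1<..<1}"
      by (simp add: emeasure_density mult.commute)
    also have "\<dots> = (SUP n. emeasure (density lborel (indicator A)) {tanh (-real n)..tanh (real n)})"
      unfolding un[symmetric] by (rule SUP_emeasure_incseq[OF r1 i1, symmetric])
    also have "\<dots> = (SUP n. ?b n)"
      using 1 by (simp add: emeasure_density)
    also have "\<dots> = (SUP n. emeasure (density lborel (\<lambda>a. indicator A (tanh a) * ennreal (g a))) {-real n..real n})"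
      by (simp add: emeasure_density)
    also have "\<dots> = emeasure (density lborel (\<lambda>a. indicator A (tanh a) * ennreal (g a))) (\<Union>n. {-real n..real n})"
      by (rule SUP_emeasure_incseq[OF r2 i2])
    also have "\<dots> = emeasure (distr (density lborel g) borel tanh) A"
      using measurable_sets_borel[OF borel_measurable_hyperbolic(1) A]
      unfolding un2 by (simp add: emeasure_density emeasure_distr indicator_vimage[symmetric] mult.commute)
    finally show ?thesis .
  qed
  hence eq: "density lborel (indicator {-1<..<1}) = distr (density lborel g) borel tanh"
    by (intro measure_eqI) (simp, simp)
  have "(\<integral>\<^sup>+x\<in>{-1<..<1}. f x \<partial>lborel) = (\<integral>\<^sup>+x. f x \<partial>density lborel (indicator {-1<..<1}))"
    by (simp add: nn_integral_density mult.commute)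
  also have "\<dots> = (\<integral>\<^sup>+a. f (tanh a) * g a \<partial>lborel)"
    unfolding eq by (simp add: nn_integral_distr nn_integral_density mult.commute)
  finally show ?thesis by (simp add: g_def)
qed

lemma nn_integral_tanh_real:
  fixes f :: "real \<Rightarrow> real"
  assumes [measurable]: "f \<in> borel_measurable borel"
  shows "(\<integral>\<^sup>+x\<in>{-1<..<1}. ennreal (f x) \<partial>lborel) = (\<integral>\<^sup>+a. ennreal (f (tanh a) * (1 / (cosh a)\<^sup>2)) \<partial>lborel)"
  by (subst nn_integral_tanh) (simp_all only: ennreal_mult'' zero_le_divide_1_iff zero_le_power2, measurable)

section \<open>The energies in hyperbolic coordinates\<close>

text \<open>
  The kernel \<open>\<bar>x - y\<bar> powr (- 1 - \<alpha>)\<close>, with weights and Jacobians, as a function of \<open>a - b\<close>.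
\<close>

definition hyp_kernel :: "real \<Rightarrow> real \<Rightarrow> real" where
  "hyp_kernel \<alpha> r = 1 / \<bar>sinh r\<bar> powr (1 + \<alpha>)"

text \<open>
  This is \<open>u / w\<close> at \<open>tanh a\<close>, see \<open>profile_eq\<close>; the form below avoids a quotient.
\<close>

definition profile :: "real \<Rightarrow> (real \<Rightarrow> real) \<Rightarrow> real \<Rightarrow> real" where
  "profile \<alpha> u a = u (tanh a) * cosh a powr (\<alpha> - 1)"

lemma hyp_kernel_nonneg [simp]: "hyp_kernel \<alpha> r \<ge> 0"
  by (simp add: hyp_kernel_def)

lemma hyp_kernel_minus [simp]: "hyp_kernel \<alpha> (-r) = hyp_kernel \<alpha> r"
  by (simp add: hyp_kernel_def)

lemma borel_measurable_hyp_kernel [measurable]: "hyp_kernel \<alpha> \<in> borel_measurable borel"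
  unfolding hyp_kernel_def[abs_def] by measurable

lemma borel_measurable_profile [measurable]:
  assumes [measurable]: "u \<in> borel_measurable borel"
  shows "profile \<alpha> u \<in> borel_measurable borel"
  unfolding profile_def[abs_def] by measurable

text \<open>
  The Jacobians of both variables combine with the kernel: the difference kernel is, up to a factor in \<open>a\<close>
  and one in \<open>b\<close>, a function of \<open>a - b\<close>, and these factors are reciprocal to the weight \<open>w\<close>.
\<close>

lemma tanh_kernel:
  "1 / \<bar>tanh a - tanh b\<bar> powr (1 + \<alpha>) * (1 / (cosh a)\<^sup>2) * (1 / (cosh b)\<^sup>2)
     = hyp_kernel \<alpha> (a - b) * cosh a powr (\<alpha> - 1) * cosh b powr (\<alpha> - 1)"
proof -
  have p: "cosh c powr (\<alpha> - 1) = cosh c powr (1 + \<alpha>) / (cosh c)\<^sup>2" for c :: real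
    using powr_diff[of "cosh c" "1+\<alpha>" 2] by (simp add: powr_numeral)
  show ?thesis unfolding p hyp_kernel_def tanh_diff_sinh
    by (simp add: abs_mult powr_divide powr_mult)
qed

lemma w_tanh: "w \<alpha> (tanh a) = cosh a powr (1 - \<alpha>)"
proof -
  have "1 / (cosh a)\<^sup>2 = cosh a powr (-2)"
    using powr_minus_divide[of "cosh a" 2] powr_numeral[of "cosh a" "num.Bit0 num.One"] by simp
  hence "w \<alpha> (tanh a) = (cosh a powr (-2)) powr ((\<alpha> - 1) / 2)"
    unfolding w_def one_minus_tanh_sq by simp
  also have "\<dots> = cosh a powr (1 - \<alpha>)"
    unfolding powr_powr by (rule arg_cong[of _ _ "(powr) (cosh a)"]) simp
  finally show ?thesis .
qed

lemma profile_eq: "profile \<alpha> u a = u (tanh a) / w \<alpha> (tanh a)"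
  by (simp add: profile_def w_tanh powr_diff field_simps)

lemma nn_integral_tanh_double:
  fixes F :: "real \<Rightarrow> real \<Rightarrow> real"
  assumes [measurable]: "(\<lambda>(x, y). F x y) \<in> borel_measurable (borel \<Otimes>\<^sub>M borel)"
  assumes nn: "\<And>x y. F x y \<ge> 0"
  shows "(\<integral>\<^sup>+y\<in>{-1<..<1}. (\<integral>\<^sup>+x\<in>{-1<..<1}. ennreal (F x y) \<partial>lborel) \<partial>lborel)
    = (\<integral>\<^sup>+b. (\<integral>\<^sup>+a. ennreal (F (tanh a) (tanh b) * (1 / (cosh a)\<^sup>2) * (1 / (cosh b)\<^sup>2)) \<partial>lborel) \<partial>lborel)"
proof -
  have "(\<integral>\<^sup>+y\<in>{-1<..<1}. (\<integral>\<^sup>+x\<in>{-1<..<1}. ennreal (F x y) \<partial>lborel) \<partial>lborel)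
     = (\<integral>\<^sup>+b. (\<integral>\<^sup>+x\<in>{-1<..<1}. ennreal (F x (tanh b)) \<partial>lborel) * ennreal (1 / (cosh b)\<^sup>2) \<partial>lborel)"
    by (subst nn_integral_tanh) simp_all
  also have "\<dots> = (\<integral>\<^sup>+b. (\<integral>\<^sup>+a. ennreal (F (tanh a) (tanh b)) * ennreal (1 / (cosh a)\<^sup>2) \<partial>lborel) * ennreal (1 / (cosh b)\<^sup>2) \<partial>lborel)"
    by (subst nn_integral_tanh) simp_all
  also have "\<dots> = (\<integral>\<^sup>+b. (\<integral>\<^sup>+a. ennreal (F (tanh a) (tanh b) * (1 / (cosh a)\<^sup>2) * (1 / (cosh b)\<^sup>2)) \<partial>lborel) \<partial>lborel)"
    by (simp add: nn_integral_multc[symmetric] ennreal_mult[symmetric] nn)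
  finally show ?thesis .
qed

lemma weighted_energy_profile:
  assumes [measurable]: "u \<in> borel_measurable borel"
  shows "weighted_energy \<alpha> u = ennreal (1/2) *
    (\<integral>\<^sup>+b. (\<integral>\<^sup>+a. ennreal ((profile \<alpha> u a - profile \<alpha> u b)\<^sup>2 * hyp_kernel \<alpha> (a - b)) \<partial>lborel) \<partial>lborel)"
proof -
  have [measurable]: "w \<alpha> \<in> borel_measurable borel" unfolding w_def[abs_def] by measurable
  have eq: "(u (tanh a) / w \<alpha> (tanh a) - u (tanh b) / w \<alpha> (tanh b))\<^sup>2 * (w \<alpha> (tanh a) * w \<alpha> (tanh b) / \<bar>tanh a - tanh b\<bar> powr (1 + \<alpha>))
      * (1 / (cosh a)\<^sup>2) * (1 / (cosh b)\<^sup>2)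
     = (profile \<alpha> u a - profile \<alpha> u b)\<^sup>2 * hyp_kernel \<alpha> (a - b)" (is "?l = ?r") for a b
  proof -
    have "?l = (profile \<alpha> u a - profile \<alpha> u b)\<^sup>2 * (w \<alpha> (tanh a) * w \<alpha> (tanh b))
       * (1 / \<bar>tanh a - tanh b\<bar> powr (1 + \<alpha>) * (1 / (cosh a)\<^sup>2) * (1 / (cosh b)\<^sup>2))"
      by (simp add: profile_eq mult_ac)
    also have "\<dots> = ?r * (cosh a powr (1 - \<alpha>) * cosh a powr (\<alpha> - 1)) * (cosh b powr (1 - \<alpha>) * cosh b powr (\<alpha> - 1))"
      unfolding tanh_kernel w_tanh by (simp add: mult_ac)
    also have "\<dots> = ?r" by (simp add: powr_add[symmetric])
    finally show ?thesis .
  qed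
  show ?thesis unfolding weighted_energy_def
    by (subst nn_integral_tanh_double) (simp_all only: eq, measurable, simp add: w_def)
qed

lemma interior_energy_profile:
  assumes [measurable]: "u \<in> borel_measurable borel"
  shows "(\<integral>\<^sup>+y\<in>{-1<..<1}. (\<integral>\<^sup>+x\<in>{-1<..<1}. ennreal ((u x - u y)\<^sup>2 / \<bar>x - y\<bar> powr (1 + \<alpha>)) \<partial>lborel) \<partial>lborel)
    = (\<integral>\<^sup>+b. (\<integral>\<^sup>+a. ennreal ((u (tanh a) - u (tanh b))\<^sup>2 * (cosh a * cosh b) powr (\<alpha> - 1) * hyp_kernel \<alpha> (a - b)) \<partial>lborel) \<partial>lborel)"
proof -
  have eq: "(u (tanh a) - u (tanh b))\<^sup>2 / \<bar>tanh a - tanh b\<bar> powr (1 + \<alpha>) * (1 / (cosh a)\<^sup>2) * (1 / (cosh b)\<^sup>2)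
     = (u (tanh a) - u (tanh b))\<^sup>2 * (cosh a * cosh b) powr (\<alpha> - 1) * hyp_kernel \<alpha> (a - b)" for a b
    using arg_cong[OF tanh_kernel, of "\<lambda>z. (u (tanh a) - u (tanh b))\<^sup>2 * z" a b \<alpha>]
    by (simp add: powr_mult mult_ac)
  have "(\<lambda>(x, y). (u x - u y)\<^sup>2 / \<bar>x - y\<bar> powr (1 + \<alpha>)) \<in> borel_measurable (borel \<Otimes>\<^sub>M borel)"
    by measurable
  from nn_integral_tanh_double[OF this] show ?thesis
    unfolding eq by simp
qed

section \<open>Integrals of the truncated kernel\<close>

definition cut_kernel :: "real \<Rightarrow> real \<Rightarrow> real \<Rightarrow> real" where
  "cut_kernel \<alpha> \<epsilon> r = hyp_kernel \<alpha> r * indicator {r. \<epsilon> \<le> \<bar>r\<bar>} r"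

lemma cut_kernel_nonneg [simp]: "cut_kernel \<alpha> \<epsilon> r \<ge> 0"
  by (simp add: cut_kernel_def)

lemma cut_kernel_minus [simp]: "cut_kernel \<alpha> \<epsilon> (-r) = cut_kernel \<alpha> \<epsilon> r"
  by (simp add: cut_kernel_def indicator_def)

lemma borel_measurable_cut_kernel [measurable]: "cut_kernel \<alpha> \<epsilon> \<in> borel_measurable borel"
  unfolding cut_kernel_def[abs_def] by measurable

lemma cut_kernel_eq: "\<epsilon> > 0 \<Longrightarrow> r \<ge> \<epsilon> \<Longrightarrow> cut_kernel \<alpha> \<epsilon> r = 1 / sinh r powr (1 + \<alpha>)"
  by (simp add: cut_kernel_def hyp_kernel_def)

text \<open>
  Reduces kernels cut off near the origin to the half-line, where the fundamental theorem of calculus applies.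
\<close>

lemma nn_integral_split_even:
  fixes f :: "real \<Rightarrow> ennreal"
  assumes [measurable]: "f \<in> borel_measurable borel" and "\<epsilon> > 0"
  assumes 0: "\<And>r. \<bar>r\<bar> < \<epsilon> \<Longrightarrow> f r = 0"
  shows "(\<integral>\<^sup>+r. f r \<partial>lborel) = (\<integral>\<^sup>+r\<in>{\<epsilon>..}. f r \<partial>lborel) + (\<integral>\<^sup>+r\<in>{\<epsilon>..}. f (-r) \<partial>lborel)"
proof -
  have "(\<integral>\<^sup>+r. f r \<partial>lborel) = (\<integral>\<^sup>+r. f r * indicator {\<epsilon>..} r + f r * indicator {..-\<epsilon>} r \<partial>lborel)"
  proof (intro nn_integral_cong)
    fix r show "f r = f r * indicator {\<epsilon>..} r + f r * indicator {..-\<epsilon>} r"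
      using 0[of r] \<open>\<epsilon> > 0\<close> by (cases "\<bar>r\<bar> < \<epsilon>") (auto simp: indicator_def)
  qed
  also have "\<dots> = (\<integral>\<^sup>+r\<in>{\<epsilon>..}. f r \<partial>lborel) + (\<integral>\<^sup>+r\<in>{..-\<epsilon>}. f r \<partial>lborel)"
    by (rule nn_integral_add) auto
  also have "(\<integral>\<^sup>+r\<in>{..-\<epsilon>}. f r \<partial>lborel) = (\<integral>\<^sup>+r\<in>{\<epsilon>..}. f (-r) \<partial>lborel)"
    using nn_integral_real_affine[of "\<lambda>r. f r * indicator {..-\<epsilon>} r" "-1" 0]
    by (simp add: indicator_def)
  finally show ?thesis .
qed

lemma cosh_ratio: "cosh (a + r) / cosh a = cosh r + tanh a * sinh (r::real)"
  by (simp add: cosh_add tanh_def field_simps)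

lemma coth_gt_1: "(r::real) > 0 \<Longrightarrow> cosh r / sinh r > 1"
  by (simp add: sinh_less_cosh_real)

text \<open>
  On the half-line, \<open>cosh (a + r) / cosh a = sinh r * (coth r + tanh a)\<close>. The powers of \<open>sinh r\<close> in
  the integrand collapse to \<open>1 / sinh\<^sup>2 r\<close>, which is minus the derivative of \<open>coth r\<close>.
\<close>

lemma nn_integral_cosh_ratio_half:
  fixes a :: real
  assumes "\<alpha> > 0" and e: "\<epsilon> > 0"
  shows "(\<integral>\<^sup>+r\<in>{\<epsilon>..}. ennreal (cut_kernel \<alpha> \<epsilon> r * (cosh (a + r) / cosh a) powr (\<alpha> - 1)) \<partial>lborel)
     = ennreal (((cosh \<epsilon> / sinh \<epsilon> + tanh a) powr \<alpha> - (1 + tanh a) powr \<alpha>) / \<alpha>)"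
proof -
  define x where "x = tanh a"
  have x: "-1 < x" "x < 1" using tanh_real_bounds[of a] by (auto simp: x_def)
  have pos: "cosh r / sinh r + x > 0" if "r \<ge> \<epsilon>" for r
    using coth_gt_1[of r] that e x by linarith
  define f where "f = (\<lambda>r. (cosh r / sinh r + x) powr (\<alpha> - 1) / (sinh r)\<^sup>2)"
  have eq: "cut_kernel \<alpha> \<epsilon> r * (cosh (a + r) / cosh a) powr (\<alpha> - 1) = f r" if r: "r \<ge> \<epsilon>" for r
  proof -
    have s: "sinh r > 0" using r e by simp
    have "cosh (a + r) / cosh a = sinh r * (cosh r / sinh r + x)"
      unfolding cosh_ratio x_def using s by (simp add: field_simps)
    hence "cut_kernel \<alpha> \<epsilon> r * (cosh (a + r) / cosh a) powr (\<alpha> - 1)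
        = (cosh r / sinh r + x) powr (\<alpha> - 1) * (sinh r powr (\<alpha> - 1) / sinh r powr (1 + \<alpha>))"
      using s pos[OF r] r e by (simp add: cut_kernel_eq powr_mult)
    also have "sinh r powr (\<alpha> - 1) / sinh r powr (1 + \<alpha>) = 1 / (sinh r)\<^sup>2"
      using s powr_diff[of "sinh r" "\<alpha> - 1" "1 + \<alpha>"] powr_minus_divide[of "sinh r" 2] by simp
    finally show ?thesis by (simp add: f_def)
  qed
  have "(\<integral>\<^sup>+r\<in>{\<epsilon>..}. ennreal (cut_kernel \<alpha> \<epsilon> r * (cosh (a + r) / cosh a) powr (\<alpha> - 1)) \<partial>lborel)
     = (\<integral>\<^sup>+r\<in>{\<epsilon>..}. ennreal (f r) \<partial>lborel)"
    by (intro nn_integral_cong) (simp add: eq indicator_def)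
  also have "\<dots> = ennreal (- ((1 + x) powr \<alpha> / \<alpha>) - (- ((cosh \<epsilon> / sinh \<epsilon> + x) powr \<alpha> / \<alpha>)))"
  proof (rule nn_integral_FTC_atLeast)
    show "f \<in> borel_measurable borel" unfolding f_def by measurable
    show "0 \<le> f r" for r by (simp add: f_def)
    show "((\<lambda>r. - ((cosh r / sinh r + x) powr \<alpha> / \<alpha>)) has_real_derivative f r) (at r)" if r: "\<epsilon> \<le> r" for r
    proof -
      have s: "sinh r > 0" using r e by simp
      show ?thesis
        apply (insert s pos[OF r] \<open>\<alpha> > 0\<close>)
        apply (rule derivative_eq_intros refl | simp)+
        apply (simp add: f_def cosh_square_eq power2_eq_square[symmetric])
        done
    qed
    have "((\<lambda>r. 1 / tanh r) \<longlongrightarrow> 1 / (1::real)) at_top"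
      by (intro tendsto_intros tanh_real_at_top) auto
    hence "((\<lambda>r. cosh r / sinh r) \<longlongrightarrow> (1::real)) at_top" by (simp add: tanh_def)
    thus "((\<lambda>r. - ((cosh r / sinh r + x) powr \<alpha> / \<alpha>)) \<longlongrightarrow> - ((1 + x) powr \<alpha> / \<alpha>)) at_top"
      using x by (intro tendsto_intros) (use \<open>\<alpha> > 0\<close> in auto)
  qed
  finally show ?thesis by (simp add: x_def diff_divide_distrib)
qed

text \<open>
  The second summand on the left is the contribution of the exterior of \<open>(-1,1)\<close>, in hyperbolic
  coordinates; adding it removes the boundary terms at infinity of the two half-line integrals.
\<close>

lemma nn_integral_cosh_ratio:
  fixes a :: real
  assumes "\<alpha> > 0" and e: "\<epsilon> > 0"
  shows "(\<integral>\<^sup>+r. ennreal (cut_kernel \<alpha> \<epsilon> r * (cosh (a + r) / cosh a) powr (\<alpha> - 1)) \<partial>lborel)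
    + ennreal (((1 + tanh a) powr \<alpha> + (1 - tanh a) powr \<alpha>) / \<alpha>)
     = ennreal (((cosh \<epsilon> / sinh \<epsilon> + tanh a) powr \<alpha> + (cosh \<epsilon> / sinh \<epsilon> - tanh a) powr \<alpha>) / \<alpha>)"
proof -
  have m: "cosh (a - r) = cosh (-a + r)" for r using cosh_minus[of "a - r"] by simp
  have ca: "cosh a = cosh (-a)" by simp
  have "(\<integral>\<^sup>+r. ennreal (cut_kernel \<alpha> \<epsilon> r * (cosh (a + r) / cosh a) powr (\<alpha> - 1)) \<partial>lborel)
    = (\<integral>\<^sup>+r\<in>{\<epsilon>..}. ennreal (cut_kernel \<alpha> \<epsilon> r * (cosh (a + r) / cosh a) powr (\<alpha> - 1)) \<partial>lborel)
    + (\<integral>\<^sup>+r\<in>{\<epsilon>..}. ennreal (cut_kernel \<alpha> \<epsilon> (-r) * (cosh (a + - r) / cosh a) powr (\<alpha> - 1)) \<partial>lborel)"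
    by (rule nn_integral_split_even) (use e in \<open>auto simp: cut_kernel_def indicator_def\<close>)
  also have "(\<integral>\<^sup>+r\<in>{\<epsilon>..}. ennreal (cut_kernel \<alpha> \<epsilon> (-r) * (cosh (a + - r) / cosh a) powr (\<alpha> - 1)) \<partial>lborel)
    = (\<integral>\<^sup>+r\<in>{\<epsilon>..}. ennreal (cut_kernel \<alpha> \<epsilon> r * (cosh (- a + r) / cosh (-a)) powr (\<alpha> - 1)) \<partial>lborel)"
    by (simp add: m)
  also note nn_integral_cosh_ratio_half[OF assms] 
  also note nn_integral_cosh_ratio_half[OF assms]
  finally have *: "(\<integral>\<^sup>+r. ennreal (cut_kernel \<alpha> \<epsilon> r * (cosh (a + r) / cosh a) powr (\<alpha> - 1)) \<partial>lborel)
    = ennreal (((cosh \<epsilon> / sinh \<epsilon> + tanh a) powr \<alpha> - (1 + tanh a) powr \<alpha>) / \<alpha>)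
     + ennreal (((cosh \<epsilon> / sinh \<epsilon> + tanh (-a)) powr \<alpha> - (1 + tanh (-a)) powr \<alpha>) / \<alpha>)" .
  have le: "((cosh \<epsilon> / sinh \<epsilon> + tanh b) powr \<alpha> - (1 + tanh b) powr \<alpha>) / \<alpha> \<ge> 0" for b
    using coth_gt_1[OF e] tanh_real_bounds[of b] \<open>\<alpha> > 0\<close> by (auto intro!: divide_nonneg_pos powr_mono2)
  show ?thesis unfolding *
    using le[of a] le[of "-a"] \<open>\<alpha> > 0\<close> by (simp add: ennreal_plus[symmetric] add_divide_distrib diff_divide_distrib del: ennreal_plus)
qed

section \<open>Asymptotics of the truncated kernel\<close>

text \<open>
  Two applications of the mean value theorem. For \<open>\<alpha> < 2\<close> the bound tends to \<open>0\<close> as \<open>T\<close> grows,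
  uniformly in \<open>x\<close>.
\<close>

lemma second_difference_powr_bound:
  fixes T x :: real
  assumes "0 < \<alpha>" "\<alpha> < 2" "T > 1" "\<bar>x\<bar> \<le> 1"
  shows "\<bar>(T + x) powr \<alpha> + (T - x) powr \<alpha> - 2 * T powr \<alpha>\<bar> \<le> 2 * \<alpha> * \<bar>\<alpha> - 1\<bar> * (T - 1) powr (\<alpha> - 2)"
proof -
  have main: "\<bar>(T + x) powr \<alpha> + (T - x) powr \<alpha> - 2 * T powr \<alpha>\<bar> \<le> 2 * \<alpha> * \<bar>\<alpha> - 1\<bar> * (T - 1) powr (\<alpha> - 2)"
    if x: "0 < x" "x \<le> 1" for x
  proof -
    have "\<exists>z>0. z < x \<and> ((T + x) powr \<alpha> + (T - x) powr \<alpha>) - ((T + 0) powr \<alpha> + (T - 0) powr \<alpha>)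
      = (x - 0) * (\<alpha> * (T + z) powr (\<alpha> - 1) - \<alpha> * (T - z) powr (\<alpha> - 1))"
      using x(1) by (rule MVT2) (use x \<open>T > 1\<close> in \<open>auto intro!: derivative_eq_intros\<close>)
    then obtain z where z: "0 < z" "z < x" "((T + x) powr \<alpha> + (T - x) powr \<alpha>) - 2 * T powr \<alpha>
      = x * \<alpha> * ((T + z) powr (\<alpha> - 1) - (T - z) powr (\<alpha> - 1))" by (auto simp: algebra_simps)
    have "\<exists>y>T - z. y < T + z \<and> (T + z) powr (\<alpha> - 1) - (T - z) powr (\<alpha> - 1)
       = ((T + z) - (T - z)) * ((\<alpha> - 1) * y powr (\<alpha> - 1 - 1))"
      by (rule MVT2) (use x z \<open>T > 1\<close> in \<open>auto intro!: derivative_eq_intros\<close>)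
    then obtain y where y: "y > T - z" "(T + z) powr (\<alpha> - 1) - (T - z) powr (\<alpha> - 1)
       = 2 * z * ((\<alpha> - 1) * y powr (\<alpha> - 2))" by auto
    have "y powr (\<alpha> - 2) \<le> (T - 1) powr (\<alpha> - 2)"
      using y(1) z x assms by (intro powr_mono2') auto
    moreover have "x * z \<le> 1" using x z mult_mono[of x 1 z 1] by auto
    ultimately have "(x * z) * y powr (\<alpha> - 2) \<le> 1 * (T - 1) powr (\<alpha> - 2)"
      by (intro mult_mono) auto
    hence "2 * \<alpha> * \<bar>\<alpha> - 1\<bar> * ((x * z) * y powr (\<alpha> - 2)) \<le> 2 * \<alpha> * \<bar>\<alpha> - 1\<bar> * (T - 1) powr (\<alpha> - 2)"
      using \<open>\<alpha> > 0\<close> by (intro mult_left_mono) auto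
    thus ?thesis unfolding z(3) y(2) using x z \<open>\<alpha> > 0\<close> by (simp add: abs_mult mult_ac)
  qed
  consider "x = 0" | "x > 0" | "-x > 0" by linarith
  thus ?thesis
  proof cases
    case 1 thus ?thesis using \<open>\<alpha> > 0\<close> by simp
  next
    case 2 thus ?thesis using main[of x] assms by simp
  next
    case 3 thus ?thesis using main[of "-x"] assms by (simp add: add.commute)
  qed
qed

lemma tanh_artanh:
  assumes "-1 < x" "x < (1::real)"
  shows "tanh (artanh x) = x"
proof -
  define z where "z = (1 + x) / (1 - x)"
  have z: "z > 0" using assms by (simp add: z_def)
  have "artanh x = ln (sqrt z)" using z by (simp add: artanh_def z_def[symmetric] ln_sqrt)
  hence "tanh (artanh x) = (z - 1) / (z + 1)" using z by (simp add: tanh_ln_real)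
  also have "\<dots> = x" using assms by (simp add: z_def field_simps)
  finally show ?thesis .
qed

text \<open>
  The substitution \<open>t = tanh\<^sup>2 r\<close> turns this into Euler's integral.
\<close>

lemma nn_integral_sinh_Beta:
  fixes \<alpha> :: real
  assumes "0 < \<alpha>" "\<alpha> < 2"
  shows "(\<integral>\<^sup>+r\<in>{0<..}. ennreal (sinh r powr (1 - \<alpha>) / (cosh r)\<^sup>2) \<partial>lborel)
     = ennreal (Beta ((1 + \<alpha>) / 2) ((2 - \<alpha>) / 2) / 2)"
proof -
  define a b where "a = (2 - \<alpha>) / 2" and "b = (1 + \<alpha>) / 2"
  define f where "f = (\<lambda>t::real. t powr (a - 1) * (1 - t) powr (b - 1))"
  define g where "g = (\<lambda>r::real. (tanh r)\<^sup>2)"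
  define h where "h = (\<lambda>r::real. 2 * tanh r * (1 - (tanh r)\<^sup>2))"
  have ab: "a > 0" "b > 0" using assms by (auto simp: a_def b_def)
  have img: "g ` {0<..} = {0<..<1}"
  proof (intro equalityI subsetI)
    fix t assume "t \<in> g ` {0<..}"
    then obtain r where "r > 0" "t = (tanh r)\<^sup>2" by (auto simp: g_def)
    thus "t \<in> {0<..<1}" using tanh_real_lt_1[of r] by (auto simp: power_less_one_iff)
  next
    fix t :: real assume t: "t \<in> {0<..<1}"
    hence "0 < sqrt t" "sqrt t < 1" by auto
    hence th: "tanh (artanh (sqrt t)) = sqrt t" by (intro tanh_artanh) linarith+
    hence "artanh (sqrt t) > 0"
      using tanh_real_pos_iff[of "artanh (sqrt t)"] \<open>0 < sqrt t\<close> by argo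
    moreover have "t = g (artanh (sqrt t))" using th t by (simp add: g_def)
    ultimately show "t \<in> g ` {0<..}" by blast
  qed
  have inj: "inj_on g {0<..}"
    by (auto simp: inj_on_def g_def power2_eq_iff_nonneg)
  have f: "(f has_integral Beta a b) {0<..<1}"
    using has_integral_Beta_real[OF ab] by (simp add: f_def has_integral_Icc_iff_Ioo)
  have "f absolutely_integrable_on {0<..<1}"
    using f by (intro nonnegative_absolutely_integrable_1) (auto simp: f_def)
  moreover have "integral {0<..<1} f = Beta a b" using f by (rule integral_unique)
  ultimately have "(\<lambda>r. \<bar>h r\<bar> * f (g r)) absolutely_integrable_on {0<..} \<and>
      integral {0<..} (\<lambda>r. \<bar>h r\<bar> * f (g r)) = Beta a b"
    using img inj by (subst has_absolute_integral_change_of_variables_1')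
      (auto simp: g_def h_def intro!: derivative_eq_intros)
  hence hi: "((\<lambda>r. \<bar>h r\<bar> * f (g r)) has_integral Beta a b) {0<..}"
    by (metis absolutely_integrable_on_def has_integral_integral)
  have eq: "\<bar>h r\<bar> * f (g r) = 2 * (sinh r powr (1 - \<alpha>) / (cosh r)\<^sup>2)" if "r > 0" for r
  proof -
    have s: "sinh r > 0" and c: "cosh r > 0" using that by auto
    \<comment> \<open>Both sides are powers of \<open>sinh r\<close> and \<open>cosh r\<close>, compared through their logarithms.\<close>
    have ln1: "ln (tanh r) = ln (sinh r) - ln (cosh r)" using s c by (simp add: tanh_def ln_div)
    have t: "tanh r > 0" using that by simp
    have "\<bar>h r\<bar> = 2 * exp (ln (sinh r) - ln (cosh r)) * exp (- 2 * ln (cosh r))"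
      using t c s by (simp add: h_def one_minus_tanh_sq abs_mult ln1[symmetric] exp_minus field_simps exp_double)
    moreover have "f (g r) = exp ((a - 1) * (2 * (ln (sinh r) - ln (cosh r)))) * exp ((b - 1) * (- 2 * ln (cosh r)))"
    proof -
      have "1 - g r > 0" unfolding g_def one_minus_tanh_sq using c by simp
      moreover have "ln (1 - g r) = - 2 * ln (cosh r)"
        unfolding g_def one_minus_tanh_sq using c by (simp add: ln_div ln_realpow)
      moreover have "g r > 0" "ln (g r) = 2 * (ln (sinh r) - ln (cosh r))"
        using t by (simp_all add: g_def ln_realpow ln1)
      ultimately show ?thesis by (simp add: f_def powr_def)
    qed
    ultimately have "\<bar>h r\<bar> * f (g r) = 2 * exp ((ln (sinh r) - ln (cosh r)) + (- 2 * ln (cosh r))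
        + (a - 1) * (2 * (ln (sinh r) - ln (cosh r))) + (b - 1) * (- 2 * ln (cosh r)))"
      by (simp only: exp_add mult_ac)
    also have "(ln (sinh r) - ln (cosh r)) + (- 2 * ln (cosh r))
        + (a - 1) * (2 * (ln (sinh r) - ln (cosh r))) + (b - 1) * (- 2 * ln (cosh r))
        = (1 - \<alpha>) * ln (sinh r) + - 2 * ln (cosh r)"
      by (simp add: a_def b_def field_simps)
    also have "2 * exp ((1 - \<alpha>) * ln (sinh r) + - 2 * ln (cosh r)) = 2 * (sinh r powr (1 - \<alpha>) / (cosh r)\<^sup>2)"
      using s c by (simp add: powr_def exp_diff exp_double)
    finally show ?thesis .
  qed
  have "((\<lambda>r. 2 * (sinh r powr (1 - \<alpha>) / (cosh r)\<^sup>2)) has_integral Beta a b) {0<..}"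
    using hi by (rule has_integral_eq[rotated]) (use eq in auto)
  hence "((\<lambda>r. sinh r powr (1 - \<alpha>) / (cosh r)\<^sup>2) has_integral Beta a b / 2) {0<..}"
    by (auto dest: has_integral_divide[where c = 2])
  hence "(\<integral>\<^sup>+r\<in>{0<..}. ennreal (sinh r powr (1 - \<alpha>) / (cosh r)\<^sup>2) \<partial>lborel) = ennreal (Beta a b / 2)"
    by (intro nn_integral_has_integral_lebesgue') auto
  thus ?thesis by (simp add: a_def b_def Beta_commute)
qed

text \<open>
  Integration by parts: \<open>- sinh r powr (- \<alpha>) / cosh r\<close> has derivative
  \<open>\<alpha> / sinh r powr (1 + \<alpha>) + sinh r powr (1 - \<alpha>) / cosh\<^sup>2 r\<close>. It trades the divergent mass of the kernel
  near \<open>0\<close> for a convergent integral and an explicit boundary term.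
\<close>

lemma nn_integral_sinh_parts:
  fixes \<alpha> \<epsilon> :: real
  assumes "0 < \<alpha>" "\<epsilon> > 0"
  shows "ennreal \<alpha> * (\<integral>\<^sup>+r\<in>{\<epsilon>..}. ennreal (1 / sinh r powr (1 + \<alpha>)) \<partial>lborel)
    + (\<integral>\<^sup>+r\<in>{\<epsilon>..}. ennreal (sinh r powr (1 - \<alpha>) / (cosh r)\<^sup>2) \<partial>lborel)
    = ennreal (sinh \<epsilon> powr (-\<alpha>) / cosh \<epsilon>)"
proof -
  define f where "f = (\<lambda>r. \<alpha> / sinh r powr (1 + \<alpha>) + sinh r powr (1 - \<alpha>) / (cosh r)\<^sup>2)"
  have "ennreal \<alpha> * (\<integral>\<^sup>+r\<in>{\<epsilon>..}. ennreal (1 / sinh r powr (1 + \<alpha>)) \<partial>lborel)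
     + (\<integral>\<^sup>+r\<in>{\<epsilon>..}. ennreal (sinh r powr (1 - \<alpha>) / (cosh r)\<^sup>2) \<partial>lborel)
    = (\<integral>\<^sup>+r. ennreal \<alpha> * (ennreal (1 / sinh r powr (1 + \<alpha>)) * indicator {\<epsilon>..} r)
        + ennreal (sinh r powr (1 - \<alpha>) / (cosh r)\<^sup>2) * indicator {\<epsilon>..} r \<partial>lborel)"
    by (subst nn_integral_add) (auto simp: nn_integral_cmult)
  also have "\<dots> = (\<integral>\<^sup>+r\<in>{\<epsilon>..}. ennreal (f r) \<partial>lborel)"
    using \<open>0 < \<alpha>\<close> by (intro nn_integral_cong)
      (auto simp: f_def indicator_def ennreal_mult'[symmetric] simp flip: ennreal_plus)
  also have "\<dots> = ennreal (0 - (- (sinh \<epsilon> powr (-\<alpha>) / cosh \<epsilon>)))"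
  proof (rule nn_integral_FTC_atLeast)
    show "f \<in> borel_measurable borel" unfolding f_def by measurable
    show "0 \<le> f r" for r using \<open>0 < \<alpha>\<close> by (simp add: f_def)
    show "((\<lambda>r. - (sinh r powr (-\<alpha>) / cosh r)) has_real_derivative f r) (at r)" if r: "\<epsilon> \<le> r" for r
    proof -
      have s: "sinh r > 0" and c: "cosh r > 0" using r assms by auto
      have "((\<lambda>r. - (sinh r powr (-\<alpha>) / cosh r)) has_real_derivative
         - ((-\<alpha> * sinh r powr (-\<alpha> - 1) * cosh r * cosh r - sinh r powr (-\<alpha>) * sinh r) / (cosh r * cosh r))) (at r)"
        using s c by (auto intro!: derivative_eq_intros)
      also have "- ((-\<alpha> * sinh r powr (-\<alpha> - 1) * cosh r * cosh r - sinh r powr (-\<alpha>) * sinh r) / (cosh r * cosh r)) = f r"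
      proof -
        have "sinh r powr (-\<alpha>) * sinh r = sinh r powr (1 - \<alpha>)"
          using s powr_mult_base[of "sinh r" "-\<alpha>"] by (simp add: mult.commute)
        moreover have "sinh r powr (-\<alpha> - 1) = 1 / sinh r powr (1 + \<alpha>)"
        proof -
          have "-\<alpha> - 1 = - (1 + \<alpha>)" by simp
          thus ?thesis by (simp only: powr_minus_divide)
        qed
        ultimately show ?thesis using c by (simp add: f_def field_simps power2_eq_square)
      qed
      finally show ?thesis .
    qed
    have "((\<lambda>r. sinh r powr (-\<alpha>)) \<longlongrightarrow> 0) at_top"
      using tendsto_neg_powr[of "-\<alpha>", OF _ sinh_real_at_top] \<open>0 < \<alpha>\<close> by simp
    moreover have "((\<lambda>r::real. inverse (cosh r)) \<longlongrightarrow> 0) at_top"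
      by (rule tendsto_inverse_0_at_top[OF cosh_real_at_top])
    ultimately have "((\<lambda>r. sinh r powr (-\<alpha>) * inverse (cosh r)) \<longlongrightarrow> 0 * 0) at_top"
      by (rule tendsto_mult)
    thus "((\<lambda>r. - (sinh r powr (-\<alpha>) / cosh r)) \<longlongrightarrow> 0) at_top"
      by (auto simp: divide_inverse intro: tendsto_eq_intros)
  qed
  finally show ?thesis by simp
qed

text \<open>
  The divergent boundary terms \<open>coth \<epsilon> powr \<alpha>\<close> and \<open>sinh \<epsilon> powr (- \<alpha>) / cosh \<epsilon>\<close> agree up to
  \<open>O(\<epsilon> powr (2 - \<alpha>))\<close>: after factoring out \<open>sinh \<epsilon> powr (- \<alpha>)\<close>, both \<open>cosh \<epsilon> powr \<alpha>\<close> and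
  \<open>1 / cosh \<epsilon>\<close> lie within \<open>sinh\<^sup>2 \<epsilon>\<close> of \<open>1\<close>.
\<close>

lemma coth_powr_bound:
  fixes \<alpha> \<epsilon> :: real
  assumes "0 < \<alpha>" "\<alpha> < 2" "\<epsilon> > 0"
  shows "\<bar>(cosh \<epsilon> / sinh \<epsilon>) powr \<alpha> - sinh \<epsilon> powr (-\<alpha>) / cosh \<epsilon>\<bar> \<le> 2 * sinh \<epsilon> powr (2 - \<alpha>)"
proof -
  define s c where "s = sinh \<epsilon>" and "c = cosh \<epsilon>"
  have s: "s > 0" and c: "c \<ge> 1" and cs: "c\<^sup>2 = 1 + s\<^sup>2"
    using assms by (auto simp: s_def c_def cosh_real_ge_1 cosh_square_eq)
  have 1: "1 / c \<le> 1" using c by simp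
  have 2: "1 \<le> c powr \<alpha>" using c assms by (simp add: ge_one_powr_ge_zero)
  have "c powr \<alpha> \<le> c powr 2" using c assms by (intro powr_mono) auto
  hence 3: "c powr \<alpha> \<le> 1 + s\<^sup>2" using c cs by (simp add: powr_numeral)
  have "2 - c\<^sup>2 \<le> 1 / c"
  proof -
    have "0 \<le> (c - 1) * (c\<^sup>2 + c - 1)" using c by (intro mult_nonneg_nonneg) (auto simp: power2_eq_square add_increasing)
    hence "(2 - c\<^sup>2) * c \<le> 1" by (simp add: algebra_simps power2_eq_square)
    thus ?thesis using c by (simp add: field_simps)
  qed
  hence 4: "1 - s\<^sup>2 \<le> 1 / c" using cs by simp
  have "\<bar>(c / s) powr \<alpha> - s powr (-\<alpha>) / c\<bar> = s powr (-\<alpha>) * (c powr \<alpha> - 1 / c)"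
  proof -
    have "(c / s) powr \<alpha> - s powr (-\<alpha>) / c = s powr (-\<alpha>) * (c powr \<alpha> - 1 / c)"
      using s c by (simp add: powr_divide powr_minus field_simps)
    thus ?thesis using 1 2 by (simp add: abs_mult)
  qed
  also have "\<dots> \<le> s powr (-\<alpha>) * (2 * s\<^sup>2)"
    using 3 4 by (intro mult_left_mono) auto
  also have "\<dots> = 2 * s powr (2 - \<alpha>)"
    using s powr_add[of s "-\<alpha>" 2] by (simp add: powr_numeral)
  finally show ?thesis unfolding s_def c_def .
qed

text \<open>
  The Beta constant arises here. Both \<open>S n\<close> and the quotient diverge as the cutoff shrinks, but
  their difference converges, uniformly in \<open>x\<close>. The quotient is \<open>2 T powr \<alpha> / \<alpha>\<close> up to a second
  difference, and by \<open>nn_integral_sinh_parts\<close> the mass \<open>S n\<close> is the matching boundary term minus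
  \<open>2 / \<alpha>\<close> times an integral that tends to half the Beta value.
\<close>

lemma cut_kernel_asymptotics:
  fixes \<alpha> :: real
  assumes a: "0 < \<alpha>" "\<alpha> < 2"
  obtains S err :: "nat \<Rightarrow> real" where
    "\<And>n. S n \<ge> 0"
    "\<And>n. (\<integral>\<^sup>+r. ennreal (cut_kernel \<alpha> (1 / real (Suc n)) r) \<partial>lborel) = ennreal (S n)"
    "\<And>n x. \<bar>x\<bar> \<le> 1 \<Longrightarrow>
       \<bar>((cosh (1 / real (Suc n)) / sinh (1 / real (Suc n)) + x) powr \<alpha>
         + (cosh (1 / real (Suc n)) / sinh (1 / real (Suc n)) - x) powr \<alpha>) / \<alpha>
         - (S n + Beta ((1 + \<alpha>) / 2) ((2 - \<alpha>) / 2) / \<alpha>)\<bar> \<le> err n"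
    "err \<longlonglongrightarrow> 0"
proof -
  define B where "B = Beta ((1 + \<alpha>) / 2) ((2 - \<alpha>) / 2)"
  define e where "e = (\<lambda>n. 1 / real (Suc n))"
  have e0: "e n > 0" for n by (simp add: e_def)
  have e_lim: "e \<longlonglongrightarrow> 0" unfolding e_def by (rule lim_1_over_n[THEN LIMSEQ_Suc])
  define R where "R = (\<lambda>n. \<integral>\<^sup>+r\<in>{e n..}. ennreal (sinh r powr (1 - \<alpha>) / (cosh r)\<^sup>2) \<partial>lborel)"
  define J where "J = (\<lambda>n. \<integral>\<^sup>+r\<in>{e n..}. ennreal (1 / sinh r powr (1 + \<alpha>)) \<partial>lborel)"
  have Beta0: "B \<ge> 0" unfolding B_def Beta_def
    using a by (intro divide_nonneg_nonneg mult_nonneg_nonneg less_imp_le[OF Gamma_real_pos] add_pos_pos) simp_all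
  have "R \<longlonglongrightarrow> (\<integral>\<^sup>+r\<in>{0<..}. ennreal (sinh r powr (1 - \<alpha>) / (cosh r)\<^sup>2) \<partial>lborel)"
    unfolding R_def
  proof (rule nn_integral_LIMSEQ)
    show "incseq (\<lambda>n r. ennreal (sinh r powr (1 - \<alpha>) / (cosh r)\<^sup>2) * indicator {e n..} r)"
    proof (intro monoI le_funI mult_left_mono)
      fix m n :: nat and r assume "m \<le> n"
      hence "e n \<le> e m" by (simp add: e_def frac_le)
      thus "(indicator {e m..} r :: ennreal) \<le> indicator {e n..} r" by (auto simp: indicator_def)
    qed simp
    fix r :: real
    show "(\<lambda>n. ennreal (sinh r powr (1 - \<alpha>) / (cosh r)\<^sup>2) * indicator {e n..} r)
        \<longlonglongrightarrow> ennreal (sinh r powr (1 - \<alpha>) / (cosh r)\<^sup>2) * indicator {0<..} r"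
    proof (cases "r > 0")
      case True
      hence "eventually (\<lambda>n. e n < r) sequentially" using order_tendstoD(2)[OF e_lim] by simp
      thus ?thesis using True by (intro tendsto_eventually) (auto elim!: eventually_mono)
    next
      case False
      hence "\<not> e n \<le> r" for n using e0[of n] by linarith
      thus ?thesis using False by (intro tendsto_eventually) auto
    qed
  qed measurable
  hence "R \<longlonglongrightarrow> ennreal (B / 2)" using nn_integral_sinh_Beta[OF a] by (simp add: B_def)
  hence r_lim: "(\<lambda>n. enn2real (R n)) \<longlonglongrightarrow> B / 2" by (rule tendsto_enn2real) (use Beta0 in auto)
  have JR: "ennreal \<alpha> * J n + R n = ennreal (sinh (e n) powr (-\<alpha>) / cosh (e n))" for n
    unfolding J_def R_def by (rule nn_integral_sinh_parts[OF a(1) e0])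
  have Rfin: "R n \<noteq> top" and Jfin: "J n \<noteq> top" for n
    using JR[of n] a by (auto simp: ennreal_mult_top)
  define j where "j = (\<lambda>n. enn2real (J n))"
  define \<rho> where "\<rho> = (\<lambda>n. enn2real (R n))"
  have J: "J n = ennreal (j n)" and R: "R n = ennreal (\<rho> n)" and nn: "j n \<ge> 0" "\<rho> n \<ge> 0" for n
    using Rfin Jfin by (auto simp: j_def \<rho>_def ennreal_enn2real_if)
  have jr: "\<alpha> * j n + \<rho> n = sinh (e n) powr (-\<alpha>) / cosh (e n)" for n
    using JR[of n] nn[of n] a unfolding J R
    by (simp add: ennreal_mult[symmetric] ennreal_plus[symmetric] del: ennreal_plus)
  \<comment> \<open>The three sources of error: the second difference of \<open>t powr \<alpha>\<close> at \<open>coth (e n)\<close>, the mismatch of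
    the boundary terms, and the part of the Euler integral below \<open>e n\<close>.\<close>
  define err where "err = (\<lambda>n. 2 * \<bar>\<alpha> - 1\<bar> * (cosh (e n) / sinh (e n) - 1) powr (\<alpha> - 2)
      + (2 * (2 * sinh (e n) powr (2 - \<alpha>)) + 2 * \<bar>\<rho> n - B / 2\<bar>) / \<alpha>)"
  show ?thesis
  proof (rule that[of "\<lambda>n. 2 * j n" err])
    show "2 * j n \<ge> 0" for n using nn by simp
    show "(\<integral>\<^sup>+r. ennreal (cut_kernel \<alpha> (1 / real (Suc n)) r) \<partial>lborel) = ennreal (2 * j n)" for n
    proof -
      have "(\<integral>\<^sup>+r. ennreal (cut_kernel \<alpha> (e n) r) \<partial>lborel)
         = (\<integral>\<^sup>+r\<in>{e n..}. ennreal (cut_kernel \<alpha> (e n) r) \<partial>lborel) + (\<integral>\<^sup>+r\<in>{e n..}. ennreal (cut_kernel \<alpha> (e n) (-r)) \<partial>lborel)"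
        by (rule nn_integral_split_even) (auto simp: e0 cut_kernel_def)
      also have "\<dots> = 2 * (\<integral>\<^sup>+r\<in>{e n..}. ennreal (cut_kernel \<alpha> (e n) r) \<partial>lborel)" by (simp add: mult_2)
      also have "(\<integral>\<^sup>+r\<in>{e n..}. ennreal (cut_kernel \<alpha> (e n) r) \<partial>lborel) = J n"
        unfolding J_def by (intro nn_integral_cong) (simp add: cut_kernel_eq[OF e0] indicator_def)
      finally show ?thesis by (simp add: J nn ennreal_mult e_def)
    qed
    have "err \<longlonglongrightarrow> 2 * \<bar>\<alpha> - 1\<bar> * 0 + (2 * (2 * 0) + 2 * \<bar>B / 2 - B / 2\<bar>) / \<alpha>"
      unfolding err_def
    proof (intro tendsto_intros)
      show "\<rho> \<longlonglongrightarrow> B / 2" unfolding \<rho>_def by (rule r_lim)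
      have sl: "(\<lambda>n. sinh (e n)) \<longlonglongrightarrow> sinh 0" by (intro tendsto_intros e_lim)
      show "(\<lambda>n. sinh (e n) powr (2 - \<alpha>)) \<longlonglongrightarrow> 0"
        using tendsto_powr2[OF sl tendsto_const[of "2 - \<alpha>"]] a e0 by (simp add: less_imp_le)
      have "(\<lambda>n. exp (e n) * sinh (e n)) \<longlonglongrightarrow> exp 0 * sinh 0" by (intro tendsto_intros e_lim)
      hence "(\<lambda>n. (exp (e n) * sinh (e n)) powr (2 - \<alpha>)) \<longlonglongrightarrow> 0"
        using tendsto_powr2[OF _ tendsto_const[of "2 - \<alpha>"], of "\<lambda>n. exp (e n) * sinh (e n)" 0 sequentially] a e0
        by (simp add: less_imp_le)
      \<comment> \<open>\<open>coth t - 1 = exp (- t) / sinh t\<close>, so the negative exponent gives a quantity tending to \<open>0\<close>.\<close>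
      moreover have "(cosh (e n) / sinh (e n) - 1) powr (\<alpha> - 2) = (exp (e n) * sinh (e n)) powr (2 - \<alpha>)" for n
      proof -
        have s: "sinh (e n) > 0" using e0 by simp
        have "cosh (e n) / sinh (e n) - 1 = (cosh (e n) - sinh (e n)) / sinh (e n)"
          using s by (simp add: field_simps)
        also have "\<dots> = inverse (exp (e n) * sinh (e n))"
          by (simp add: cosh_minus_sinh exp_minus field_simps)
        finally have eq: "cosh (e n) / sinh (e n) - 1 = inverse (exp (e n) * sinh (e n))" .
        show ?thesis
          unfolding eq inverse_powr using s powr_minus[of "exp (e n) * sinh (e n)" "\<alpha> - 2"]
          by (simp del: inverse_mult_distrib)
      qed
      ultimately show "(\<lambda>n. (cosh (e n) / sinh (e n) - 1) powr (\<alpha> - 2)) \<longlonglongrightarrow> 0" by simp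
    qed (use a in auto)
    thus "err \<longlonglongrightarrow> 0" by simp
    fix n and x :: real assume x: "\<bar>x\<bar> \<le> 1"
    define T where "T = cosh (e n) / sinh (e n)"
    define q where "q = sinh (e n) powr (-\<alpha>) / cosh (e n)"
    have jj: "j n = (q - \<rho> n) / \<alpha>" using jr[of n] a by (simp add: q_def field_simps)
    have b1: "\<bar>(T + x) powr \<alpha> + (T - x) powr \<alpha> - 2 * T powr \<alpha>\<bar> \<le> 2 * \<alpha> * \<bar>\<alpha> - 1\<bar> * (T - 1) powr (\<alpha> - 2)"
      by (rule second_difference_powr_bound) (use a x coth_gt_1[OF e0] in \<open>auto simp: T_def\<close>)
    have b2: "\<bar>T powr \<alpha> - q\<bar> \<le> 2 * sinh (e n) powr (2 - \<alpha>)"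
      unfolding T_def q_def by (rule coth_powr_bound[OF a e0])
    have "((T + x) powr \<alpha> + (T - x) powr \<alpha>) / \<alpha> - (2 * j n + B / \<alpha>)
      = (((T + x) powr \<alpha> + (T - x) powr \<alpha> - 2 * T powr \<alpha>) + 2 * (T powr \<alpha> - q) + 2 * (\<rho> n - B / 2)) / \<alpha>"
      unfolding jj using a by (simp add: field_simps)
    also have "\<bar>\<dots>\<bar> = \<bar>((T + x) powr \<alpha> + (T - x) powr \<alpha> - 2 * T powr \<alpha>) + 2 * (T powr \<alpha> - q) + 2 * (\<rho> n - B / 2)\<bar> / \<alpha>"
      using a by simp
    also have "\<dots> \<le> (2 * \<alpha> * \<bar>\<alpha> - 1\<bar> * (T - 1) powr (\<alpha> - 2) + 2 * (2 * sinh (e n) powr (2 - \<alpha>)) + 2 * \<bar>\<rho> n - B / 2\<bar>) / \<alpha>"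
    proof (rule divide_right_mono)
      have "\<bar>X + 2 * Y + 2 * Z\<bar> \<le> b + 2 * c + 2 * \<bar>Z\<bar>" if "\<bar>X\<bar> \<le> b" "\<bar>Y\<bar> \<le> c" for X Y Z b c :: real
        using that by linarith
      from this[OF b1 b2] show "\<bar>((T + x) powr \<alpha> + (T - x) powr \<alpha> - 2 * T powr \<alpha>) + 2 * (T powr \<alpha> - q) + 2 * (\<rho> n - B / 2)\<bar>
        \<le> 2 * \<alpha> * \<bar>\<alpha> - 1\<bar> * (T - 1) powr (\<alpha> - 2) + 2 * (2 * sinh (e n) powr (2 - \<alpha>)) + 2 * \<bar>\<rho> n - B / 2\<bar>" .
    qed (use a in simp)
    also have "\<dots> = err n" using a by (simp add: err_def T_def field_simps)
    finally show "\<bar>((cosh (1 / real (Suc n)) / sinh (1 / real (Suc n)) + x) powr \<alpha>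
         + (cosh (1 / real (Suc n)) / sinh (1 / real (Suc n)) - x) powr \<alpha>) / \<alpha>
         - (2 * j n + Beta ((1 + \<alpha>) / 2) ((2 - \<alpha>) / 2) / \<alpha>)\<bar> \<le> err n"
      by (simp add: T_def B_def e_def)
  qed
qed

section \<open>The ground state identity for even kernels\<close>

text \<open>
  The algebra behind the ground state representation, arranged so that every term is nonnegative and the
  identity can be integrated in \<open>[0,\<infinity>]\<close> without subtraction.
\<close>

lemma profile_square_identity:
  "(u (tanh a) - u (tanh b))\<^sup>2 * (cosh a * cosh b) powr (\<alpha> - 1)
      + ((profile \<alpha> u a)\<^sup>2 + (profile \<alpha> u b)\<^sup>2)
    = (profile \<alpha> u a - profile \<alpha> u b)\<^sup>2
      + ((profile \<alpha> u a)\<^sup>2 * (cosh b / cosh a) powr (\<alpha> - 1)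
         + (profile \<alpha> u b)\<^sup>2 * (cosh a / cosh b) powr (\<alpha> - 1))"
proof -
  define A B where "A = cosh a powr (\<alpha> - 1)" and "B = cosh b powr (\<alpha> - 1)"
  have "A > 0" "B > 0" by (auto simp: A_def B_def)
  thus ?thesis unfolding profile_def
    by (simp add: powr_mult powr_divide A_def[symmetric] B_def[symmetric] field_simps power2_eq_square)
qed

text \<open>
  \<open>profile_square_identity\<close> integrated against \<open>K (a - b)\<close>. The terms depending on \<open>\<psi> a\<close> and on \<open>\<psi> b\<close>
  contribute equally because \<open>K\<close> is even, hence the factors \<open>2\<close>.
\<close>

lemma nn_integral_ground_state:
  fixes u K :: "real \<Rightarrow> real"
  assumes [measurable]: "u \<in> borel_measurable borel" "K \<in> borel_measurable borel"
  assumes K0: "\<And>r. K r \<ge> 0" and even: "\<And>r. K (-r) = K r"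
  shows "(\<integral>\<^sup>+b. (\<integral>\<^sup>+a. ennreal ((u (tanh a) - u (tanh b))\<^sup>2 * (cosh a * cosh b) powr (\<alpha> - 1) * K (a - b)) \<partial>lborel) \<partial>lborel)
      + 2 * (\<integral>\<^sup>+a. ennreal ((profile \<alpha> u a)\<^sup>2) * (\<integral>\<^sup>+r. ennreal (K r) \<partial>lborel) \<partial>lborel)
    = (\<integral>\<^sup>+b. (\<integral>\<^sup>+a. ennreal ((profile \<alpha> u a - profile \<alpha> u b)\<^sup>2 * K (a - b)) \<partial>lborel) \<partial>lborel)
      + 2 * (\<integral>\<^sup>+a. ennreal ((profile \<alpha> u a)\<^sup>2) * (\<integral>\<^sup>+r. ennreal (K r * (cosh (a + r) / cosh a) powr (\<alpha> - 1)) \<partial>lborel) \<partial>lborel)"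
proof -
  have swap: "(\<integral>\<^sup>+b. (\<integral>\<^sup>+a. F a b \<partial>lborel) \<partial>lborel) = (\<integral>\<^sup>+a. (\<integral>\<^sup>+b. F a b \<partial>lborel) \<partial>lborel)"
    if "case_prod F \<in> borel_measurable (lborel \<Otimes>\<^sub>M lborel)" for F :: "real \<Rightarrow> real \<Rightarrow> ennreal"
    using lborel_pair.Fubini'[OF that] .
  have ev: "K (a - b) = K (b - a)" for a b using even[of "a - b"] by simp
  have G: "(\<integral>\<^sup>+b. (\<integral>\<^sup>+a. ennreal (((profile \<alpha> u a)\<^sup>2 * q a b + (profile \<alpha> u b)\<^sup>2 * q b a) * K (a - b)) \<partial>lborel) \<partial>lborel)
      = 2 * (\<integral>\<^sup>+a. ennreal ((profile \<alpha> u a)\<^sup>2) * (\<integral>\<^sup>+r. ennreal (K r * q a (a + r)) \<partial>lborel) \<partial>lborel)"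
    if [measurable]: "case_prod q \<in> borel_measurable (borel \<Otimes>\<^sub>M borel)" and q0: "\<And>a b. q a b \<ge> 0" for q :: "real \<Rightarrow> real \<Rightarrow> real"
  proof -
    have one: "(\<integral>\<^sup>+b. ennreal ((profile \<alpha> u a)\<^sup>2 * q a b * K (a - b)) \<partial>lborel)
       = ennreal ((profile \<alpha> u a)\<^sup>2) * (\<integral>\<^sup>+r. ennreal (K r * q a (a + r)) \<partial>lborel)" for a
    proof -
      have "(\<integral>\<^sup>+b. ennreal ((profile \<alpha> u a)\<^sup>2 * q a b * K (a - b)) \<partial>lborel)
        = (\<integral>\<^sup>+r. ennreal ((profile \<alpha> u a)\<^sup>2 * q a (a + r) * K (a - (a + r))) \<partial>lborel)"
        using nn_integral_real_affine[of "\<lambda>b. ennreal ((profile \<alpha> u a)\<^sup>2 * q a b * K (a - b))" 1 a] by simp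
      also have "\<dots> = (\<integral>\<^sup>+r. ennreal ((profile \<alpha> u a)\<^sup>2) * ennreal (K r * q a (a + r)) \<partial>lborel)"
        by (intro nn_integral_cong) (simp add: even ennreal_mult[symmetric] K0 q0 mult_ac)
      also have "\<dots> = ennreal ((profile \<alpha> u a)\<^sup>2) * (\<integral>\<^sup>+r. ennreal (K r * q a (a + r)) \<partial>lborel)"
        by (rule nn_integral_cmult) measurable
      finally show ?thesis .
    qed
    have "(\<integral>\<^sup>+b. (\<integral>\<^sup>+a. ennreal (((profile \<alpha> u a)\<^sup>2 * q a b + (profile \<alpha> u b)\<^sup>2 * q b a) * K (a - b)) \<partial>lborel) \<partial>lborel)
      = (\<integral>\<^sup>+b. (\<integral>\<^sup>+a. ennreal ((profile \<alpha> u a)\<^sup>2 * q a b * K (a - b)) \<partial>lborel)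
               + (\<integral>\<^sup>+a. ennreal ((profile \<alpha> u b)\<^sup>2 * q b a * K (b - a)) \<partial>lborel) \<partial>lborel)"
    proof (intro nn_integral_cong)
      fix b
      have "(\<integral>\<^sup>+a. ennreal (((profile \<alpha> u a)\<^sup>2 * q a b + (profile \<alpha> u b)\<^sup>2 * q b a) * K (a - b)) \<partial>lborel)
         = (\<integral>\<^sup>+a. ennreal ((profile \<alpha> u a)\<^sup>2 * q a b * K (a - b)) + ennreal ((profile \<alpha> u b)\<^sup>2 * q b a * K (b - a)) \<partial>lborel)"
        by (intro nn_integral_cong) (simp add: ev[of b] distrib_right q0 K0 flip: ennreal_plus)
      also have "\<dots> = (\<integral>\<^sup>+a. ennreal ((profile \<alpha> u a)\<^sup>2 * q a b * K (a - b)) \<partial>lborel)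
         + (\<integral>\<^sup>+a. ennreal ((profile \<alpha> u b)\<^sup>2 * q b a * K (b - a)) \<partial>lborel)"
        by (rule nn_integral_add) measurable
      finally show "(\<integral>\<^sup>+a. ennreal (((profile \<alpha> u a)\<^sup>2 * q a b + (profile \<alpha> u b)\<^sup>2 * q b a) * K (a - b)) \<partial>lborel) = \<dots>" .
    qed
    also have "\<dots> = (\<integral>\<^sup>+b. (\<integral>\<^sup>+a. ennreal ((profile \<alpha> u a)\<^sup>2 * q a b * K (a - b)) \<partial>lborel) \<partial>lborel)
        + (\<integral>\<^sup>+b. (\<integral>\<^sup>+a. ennreal ((profile \<alpha> u b)\<^sup>2 * q b a * K (b - a)) \<partial>lborel) \<partial>lborel)"
      by (rule nn_integral_add) measurable
    also have "(\<integral>\<^sup>+b. (\<integral>\<^sup>+a. ennreal ((profile \<alpha> u a)\<^sup>2 * q a b * K (a - b)) \<partial>lborel) \<partial>lborel)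
        = (\<integral>\<^sup>+a. (\<integral>\<^sup>+b. ennreal ((profile \<alpha> u a)\<^sup>2 * q a b * K (a - b)) \<partial>lborel) \<partial>lborel)"
      by (rule swap) simp
    finally show ?thesis unfolding one by (simp add: mult_2)
  qed
  have L: "(\<integral>\<^sup>+b. (\<integral>\<^sup>+a. ennreal (X a b * K (a - b)) \<partial>lborel) \<partial>lborel) + (\<integral>\<^sup>+b. (\<integral>\<^sup>+a. ennreal (Y a b * K (a - b)) \<partial>lborel) \<partial>lborel)
     = (\<integral>\<^sup>+b. (\<integral>\<^sup>+a. ennreal ((X a b + Y a b) * K (a - b)) \<partial>lborel) \<partial>lborel)"
    if [measurable]: "case_prod X \<in> borel_measurable (borel \<Otimes>\<^sub>M borel)" "case_prod Y \<in> borel_measurable (borel \<Otimes>\<^sub>M borel)"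
      and nn: "\<And>a b. X a b \<ge> 0" "\<And>a b. Y a b \<ge> 0" for X Y :: "real \<Rightarrow> real \<Rightarrow> real"
  proof -
    have "(\<integral>\<^sup>+b. (\<integral>\<^sup>+a. ennreal ((X a b + Y a b) * K (a - b)) \<partial>lborel) \<partial>lborel)
      = (\<integral>\<^sup>+b. (\<integral>\<^sup>+a. ennreal (X a b * K (a - b)) + ennreal (Y a b * K (a - b)) \<partial>lborel) \<partial>lborel)"
      by (intro nn_integral_cong) (simp add: distrib_right nn K0 flip: ennreal_plus)
    also have "\<dots> = (\<integral>\<^sup>+b. (\<integral>\<^sup>+a. ennreal (X a b * K (a - b)) \<partial>lborel) + (\<integral>\<^sup>+a. ennreal (Y a b * K (a - b)) \<partial>lborel) \<partial>lborel)"
      by (intro nn_integral_cong nn_integral_add) measurable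
    also have "\<dots> = (\<integral>\<^sup>+b. (\<integral>\<^sup>+a. ennreal (X a b * K (a - b)) \<partial>lborel) \<partial>lborel) + (\<integral>\<^sup>+b. (\<integral>\<^sup>+a. ennreal (Y a b * K (a - b)) \<partial>lborel) \<partial>lborel)"
      by (rule nn_integral_add) measurable
    finally show ?thesis by simp
  qed
  have G1: "2 * (\<integral>\<^sup>+a. ennreal ((profile \<alpha> u a)\<^sup>2) * (\<integral>\<^sup>+r. ennreal (K r) \<partial>lborel) \<partial>lborel)
     = (\<integral>\<^sup>+b. (\<integral>\<^sup>+a. ennreal (((profile \<alpha> u a)\<^sup>2 + (profile \<alpha> u b)\<^sup>2) * K (a - b)) \<partial>lborel) \<partial>lborel)"
    using G[of "\<lambda>_ _. 1"] by simp
  have G2: "2 * (\<integral>\<^sup>+a. ennreal ((profile \<alpha> u a)\<^sup>2) * (\<integral>\<^sup>+r. ennreal (K r * (cosh (a + r) / cosh a) powr (\<alpha> - 1)) \<partial>lborel) \<partial>lborel)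
     = (\<integral>\<^sup>+b. (\<integral>\<^sup>+a. ennreal (((profile \<alpha> u a)\<^sup>2 * (cosh b / cosh a) powr (\<alpha> - 1)
         + (profile \<alpha> u b)\<^sup>2 * (cosh a / cosh b) powr (\<alpha> - 1)) * K (a - b)) \<partial>lborel) \<partial>lborel)"
    using G[of "\<lambda>a b. (cosh b / cosh a) powr (\<alpha> - 1)"] by simp
  show ?thesis unfolding G1 G2
    by (subst (1 2) L) (simp_all add: profile_square_identity)
qed

section \<open>Interaction with the exterior and removal of the truncation\<close>

lemma ennreal_half_double: "ennreal (1/2) * (2 * K) = K"
proof -
  have "ennreal (1/2) * 2 = ennreal (1/2 * 2)"
    by (subst ennreal_mult) auto
  thus ?thesis by (simp add: mult.assoc[symmetric])
qed

lemma nn_integral_exterior_half: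
  fixes \<alpha> x :: real
  assumes "0 < \<alpha>" "x < 1"
  shows "(\<integral>\<^sup>+y\<in>{1..}. ennreal (1 / \<bar>x - y\<bar> powr (1 + \<alpha>)) \<partial>lborel) = ennreal ((1 - x) powr (-\<alpha>) / \<alpha>)"
proof -
  have "(\<integral>\<^sup>+y\<in>{1..}. ennreal (1 / \<bar>x - y\<bar> powr (1 + \<alpha>)) \<partial>lborel)
     = ennreal (0 - (- ((1 - x) powr (-\<alpha>) / \<alpha>)))"
  proof (rule nn_integral_FTC_atLeast)
    show "(\<lambda>y. 1 / \<bar>x - y\<bar> powr (1 + \<alpha>)) \<in> borel_measurable borel" by measurable
    show "0 \<le> 1 / \<bar>x - y\<bar> powr (1 + \<alpha>)" for y by simp
    show "((\<lambda>y. - ((y - x) powr (-\<alpha>) / \<alpha>)) has_real_derivative 1 / \<bar>x - y\<bar> powr (1 + \<alpha>)) (at y)" if "1 \<le> y" for y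
    proof -
      have y: "y - x > 0" using that assms by linarith
      have "-\<alpha> - 1 = - (1 + \<alpha>)" by simp
      hence "(y - x) powr (-\<alpha> - 1) = 1 / (y - x) powr (1 + \<alpha>)" by (simp only: powr_minus_divide)
      thus ?thesis using y \<open>0 < \<alpha>\<close> by (auto intro!: derivative_eq_intros)
    qed
    have "filterlim (\<lambda>y. y - x) at_top at_top"
      using filterlim_tendsto_add_at_top[OF tendsto_const[of "-x"] filterlim_ident] by (simp add: algebra_simps)
    hence "((\<lambda>y. (y - x) powr (-\<alpha>)) \<longlongrightarrow> 0) at_top"
      using \<open>0 < \<alpha>\<close> by (intro tendsto_neg_powr) auto
    from tendsto_minus[OF tendsto_divide_zero[OF this]]
    show "((\<lambda>y. - ((y - x) powr (-\<alpha>) / \<alpha>)) \<longlongrightarrow> 0) at_top" by simp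
  qed
  thus ?thesis by simp
qed

lemma nn_integral_exterior:
  fixes \<alpha> x :: real
  assumes "0 < \<alpha>" "-1 < x" "x < 1"
  shows "(\<integral>\<^sup>+y\<in>-{-1<..<1}. ennreal (1 / \<bar>x - y\<bar> powr (1 + \<alpha>)) \<partial>lborel)
    = ennreal (((1 - x) powr (-\<alpha>) + (1 + x) powr (-\<alpha>)) / \<alpha>)"
proof -
  let ?f = "\<lambda>y. ennreal (1 / \<bar>x - y\<bar> powr (1 + \<alpha>)) * indicator (-{-1<..<1}) y"
  have "(\<integral>\<^sup>+y. ?f y \<partial>lborel) = (\<integral>\<^sup>+y\<in>{1..}. ?f y \<partial>lborel) + (\<integral>\<^sup>+y\<in>{1..}. ?f (-y) \<partial>lborel)"
    by (rule nn_integral_split_even) (auto simp: indicator_def)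
  also have "(\<integral>\<^sup>+y\<in>{1..}. ?f y \<partial>lborel) = (\<integral>\<^sup>+y\<in>{1..}. ennreal (1 / \<bar>x - y\<bar> powr (1 + \<alpha>)) \<partial>lborel)"
    by (intro nn_integral_cong) (auto simp: indicator_def)
  also have "(\<integral>\<^sup>+y\<in>{1..}. ?f (-y) \<partial>lborel) = (\<integral>\<^sup>+y\<in>{1..}. ennreal (1 / \<bar>-x - y\<bar> powr (1 + \<alpha>)) \<partial>lborel)"
  proof (intro nn_integral_cong)
    fix y
    have "\<bar>x - - y\<bar> = \<bar>-x - y\<bar>" by simp
    thus "?f (-y) * indicator {1..} y = ennreal (1 / \<bar>-x - y\<bar> powr (1 + \<alpha>)) * indicator {1..} y"
      by (simp only:) (auto simp: indicator_def)
  qed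
  finally show ?thesis
    using assms by (simp only: nn_integral_exterior_half) (simp add: add_divide_distrib flip: ennreal_plus)
qed

text \<open>
  Pairs with exactly one point in \<open>(-1,1)\<close> see only \<open>u\<^sup>2\<close> at that point; the other variable
  integrates to the explicit killing rate of \<open>nn_integral_exterior\<close>.
\<close>

lemma energy_split:
  fixes u :: "real \<Rightarrow> real"
  assumes a: "0 < \<alpha>" and [measurable]: "u \<in> borel_measurable borel" and u0: "\<And>x. x \<notin> {-1<..<1} \<Longrightarrow> u x = 0"
  shows "energy \<alpha> u = ennreal (1/2) *
     (\<integral>\<^sup>+y\<in>{-1<..<1}. (\<integral>\<^sup>+x\<in>{-1<..<1}. ennreal ((u x - u y)\<^sup>2 / \<bar>x - y\<bar> powr (1 + \<alpha>)) \<partial>lborel) \<partial>lborel)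
     + (\<integral>\<^sup>+x\<in>{-1<..<1}. ennreal ((u x)\<^sup>2 * (((1 - x) powr (-\<alpha>) + (1 + x) powr (-\<alpha>)) / \<alpha>)) \<partial>lborel)"
proof -
  let ?I = "{-1<..<1::real}"
  define F where "F = (\<lambda>x y. ennreal ((u x - u y)\<^sup>2 / \<bar>x - y\<bar> powr (1 + \<alpha>)))"
  define G where "G = (\<lambda>x y. ennreal ((u x)\<^sup>2 / \<bar>x - y\<bar> powr (1 + \<alpha>)) * indicator ?I x * indicator (-?I) y)"
  have [measurable]: "case_prod F \<in> borel_measurable (borel \<Otimes>\<^sub>M borel)" unfolding F_def by measurable
  have [measurable]: "case_prod G \<in> borel_measurable (borel \<Otimes>\<^sub>M borel)" unfolding G_def by measurable
  have [measurable]: "(\<lambda>x. G x y) \<in> borel_measurable borel" "(\<lambda>x. G y x) \<in> borel_measurable borel" for y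
    unfolding G_def by measurable
  have [measurable]: "(\<lambda>x. F x y) \<in> borel_measurable borel" for y
    unfolding F_def by measurable
  have FG: "F x y = F x y * indicator ?I x * indicator ?I y + (G x y + G y x)" for x y
    using u0[of x] u0[of y] by (auto simp: F_def G_def indicator_def abs_minus_commute)
  define K where "K = (\<integral>\<^sup>+x\<in>?I. ennreal ((u x)\<^sup>2 * (((1 - x) powr (-\<alpha>) + (1 + x) powr (-\<alpha>)) / \<alpha>)) \<partial>lborel)"
  have inner: "(\<integral>\<^sup>+y. G x y \<partial>lborel) = ennreal ((u x)\<^sup>2 * (((1 - x) powr (-\<alpha>) + (1 + x) powr (-\<alpha>)) / \<alpha>)) * indicator ?I x" for x
  proof (cases "x \<in> ?I")
    case True
    have "(\<integral>\<^sup>+y. G x y \<partial>lborel) = (\<integral>\<^sup>+y. ennreal ((u x)\<^sup>2) * (ennreal (1 / \<bar>x - y\<bar> powr (1 + \<alpha>)) * indicator (-?I) y) \<partial>lborel)"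
      using True by (intro nn_integral_cong) (simp add: G_def indicator_def ennreal_mult'[symmetric])
    also have "\<dots> = ennreal ((u x)\<^sup>2) * (\<integral>\<^sup>+y\<in>-?I. ennreal (1 / \<bar>x - y\<bar> powr (1 + \<alpha>)) \<partial>lborel)"
      by (rule nn_integral_cmult) measurable
    finally show ?thesis using True a by (simp add: nn_integral_exterior ennreal_mult'[symmetric])
  next
    case False thus ?thesis by (simp add: G_def)
  qed
  have G1: "(\<integral>\<^sup>+y. (\<integral>\<^sup>+x. G y x \<partial>lborel) \<partial>lborel) = K" unfolding inner K_def ..
  have G2: "(\<integral>\<^sup>+y. (\<integral>\<^sup>+x. G x y \<partial>lborel) \<partial>lborel) = K"
    by (subst lborel_pair.Fubini') (simp_all add: G1)
  have "(\<integral>\<^sup>+y. (\<integral>\<^sup>+x. F x y \<partial>lborel) \<partial>lborel)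
     = (\<integral>\<^sup>+y. (\<integral>\<^sup>+x. F x y * indicator ?I x * indicator ?I y + (G x y + G y x) \<partial>lborel) \<partial>lborel)"
    using FG by simp
  also have "\<dots> = (\<integral>\<^sup>+y. (\<integral>\<^sup>+x. F x y * indicator ?I x * indicator ?I y \<partial>lborel)
        + ((\<integral>\<^sup>+x. G x y \<partial>lborel) + (\<integral>\<^sup>+x. G y x \<partial>lborel)) \<partial>lborel)"
    by (intro nn_integral_cong) (simp add: nn_integral_add)
  also have "\<dots> = (\<integral>\<^sup>+y. (\<integral>\<^sup>+x. F x y * indicator ?I x * indicator ?I y \<partial>lborel) \<partial>lborel) + (K + K)"
    by (simp add: nn_integral_add G1 G2)
  also have "(\<integral>\<^sup>+y. (\<integral>\<^sup>+x. F x y * indicator ?I x * indicator ?I y \<partial>lborel) \<partial>lborel)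
      = (\<integral>\<^sup>+y\<in>?I. (\<integral>\<^sup>+x\<in>?I. F x y \<partial>lborel) \<partial>lborel)"
    by (intro nn_integral_cong) (simp add: nn_integral_multc)
  finally have "energy \<alpha> u = ennreal (1/2) * ((\<integral>\<^sup>+y\<in>?I. (\<integral>\<^sup>+x\<in>?I. F x y \<partial>lborel) \<partial>lborel) + (K + K))"
    by (simp add: energy_def F_def)
  moreover have "ennreal (1/2) * (K + K) = K"
    unfolding mult_2[symmetric] by (rule ennreal_half_double)
  ultimately show ?thesis by (simp add: distrib_left F_def K_def)
qed

lemma profile_sq: "(profile \<alpha> u a)\<^sup>2 = (u (tanh a))\<^sup>2 * cosh a powr (2 * \<alpha> - 2)"
  by (simp add: profile_def power_mult_distrib powr_power mult.commute right_diff_distrib)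

lemma cosh_powr_shift: "cosh (a::real) powr (2 * \<alpha>) * (1 / (cosh a)\<^sup>2) = cosh a powr (2 * \<alpha> - 2)"
  by (simp add: powr_diff powr_numeral)

lemma one_minus_tanh_sq_powr: "(1 - (tanh a)\<^sup>2) powr (-\<alpha>) = cosh (a::real) powr (2 * \<alpha>)"
proof -
  have "1 / (cosh a)\<^sup>2 = cosh a powr (-2)"
    using powr_minus_divide[of "cosh a" 2] powr_numeral[of "cosh a" "num.Bit0 num.One"] by simp
  thus ?thesis unfolding one_minus_tanh_sq by (simp add: powr_powr)
qed

lemma nn_integral_hardy_profile:
  fixes u :: "real \<Rightarrow> real"
  assumes [measurable]: "u \<in> borel_measurable borel"
  shows "(\<integral>\<^sup>+x\<in>{-1<..<1}. ennreal ((u x)\<^sup>2 * (1 - x\<^sup>2) powr (-\<alpha>)) \<partial>lborel)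
    = (\<integral>\<^sup>+a. ennreal ((profile \<alpha> u a)\<^sup>2) \<partial>lborel)"
proof -
  have eq: "(u (tanh a))\<^sup>2 * (1 - (tanh a)\<^sup>2) powr (-\<alpha>) * (1 / (cosh a)\<^sup>2) = (profile \<alpha> u a)\<^sup>2" for a
    unfolding one_minus_tanh_sq_powr profile_sq mult.assoc cosh_powr_shift ..
  show ?thesis
    by (subst nn_integral_tanh_real) (measurable, simp only: eq)
qed

lemma nn_integral_killing_profile:
  fixes u :: "real \<Rightarrow> real"
  assumes [measurable]: "u \<in> borel_measurable borel" and "0 < \<alpha>"
  shows "(\<integral>\<^sup>+x\<in>{-1<..<1}. ennreal ((u x)\<^sup>2 * (((1 - x) powr (-\<alpha>) + (1 + x) powr (-\<alpha>)) / \<alpha>)) \<partial>lborel)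
    = (\<integral>\<^sup>+a. ennreal ((profile \<alpha> u a)\<^sup>2) * ennreal (((1 + tanh a) powr \<alpha> + (1 - tanh a) powr \<alpha>) / \<alpha>) \<partial>lborel)"
proof -
  have eq: "(u (tanh a))\<^sup>2 * (((1 - tanh a) powr (-\<alpha>) + (1 + tanh a) powr (-\<alpha>)) / \<alpha>) * (1 / (cosh a)\<^sup>2)
     = (profile \<alpha> u a)\<^sup>2 * (((1 + tanh a) powr \<alpha> + (1 - tanh a) powr \<alpha>) / \<alpha>)" for a
  proof -
    have p: "1 - tanh a > 0" "1 + tanh a > 0" using tanh_real_bounds[of a] by auto
    have "cosh a powr (2 * \<alpha>) = (1 - tanh a) powr (-\<alpha>) * (1 + tanh a) powr (-\<alpha>)"
      unfolding one_minus_tanh_sq_powr[symmetric] using p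
      by (simp add: powr_mult[symmetric] power2_eq_square algebra_simps)
    hence eq: "(profile \<alpha> u a)\<^sup>2 = (u (tanh a))\<^sup>2 * ((1 - tanh a) powr (-\<alpha>) * (1 + tanh a) powr (-\<alpha>) * (1 / (cosh a)\<^sup>2))"
      unfolding profile_sq cosh_powr_shift[symmetric] by simp
    show ?thesis unfolding eq using p \<open>0 < \<alpha>\<close> by (simp add: powr_minus field_simps)
  qed
  have nn: "0 \<le> ((1 + tanh a) powr \<alpha> + (1 - tanh a) powr \<alpha>) / \<alpha>" for a
    using \<open>0 < \<alpha>\<close> by simp
  show ?thesis
    by (subst nn_integral_tanh_real) (measurable, simp only: eq ennreal_mult''[OF nn])
qed

text \<open>
  Monotone convergence, inside and outside; at \<open>r = 0\<close> both kernels take the value \<open>1 / 0 = 0\<close>.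
\<close>

lemma cut_kernel_LIMSEQ:
  fixes X :: "real \<Rightarrow> real \<Rightarrow> real"
  assumes [measurable]: "case_prod X \<in> borel_measurable (borel \<Otimes>\<^sub>M borel)" and X0: "\<And>a b. X a b \<ge> 0"
  shows "(\<lambda>n. \<integral>\<^sup>+b. (\<integral>\<^sup>+a. ennreal (X a b * cut_kernel \<alpha> (1 / real (Suc n)) (a - b)) \<partial>lborel) \<partial>lborel)
    \<longlonglongrightarrow> (\<integral>\<^sup>+b. (\<integral>\<^sup>+a. ennreal (X a b * hyp_kernel \<alpha> (a - b)) \<partial>lborel) \<partial>lborel)"
proof -
  have mono: "cut_kernel \<alpha> (1 / real (Suc m)) r \<le> cut_kernel \<alpha> (1 / real (Suc n)) r" if "m \<le> n" for m n r
  proof -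
    have "1 / real (Suc n) \<le> 1 / real (Suc m)" using that by (simp add: frac_le)
    thus ?thesis by (auto simp: cut_kernel_def indicator_def)
  qed
  have lim: "(\<lambda>n. cut_kernel \<alpha> (1 / real (Suc n)) r) \<longlonglongrightarrow> hyp_kernel \<alpha> r" for r
  proof (cases "r = 0")
    case True thus ?thesis by (simp add: cut_kernel_def hyp_kernel_def)
  next
    case False
    have "eventually (\<lambda>n. 1 / real (Suc n) < \<bar>r\<bar>) sequentially"
      using False by (intro order_tendstoD(2)[OF LIMSEQ_Suc[OF lim_1_over_n]]) auto
    hence "eventually (\<lambda>n. cut_kernel \<alpha> (1 / real (Suc n)) r = hyp_kernel \<alpha> r) sequentially"
      by (rule eventually_mono) (simp add: cut_kernel_def)
    thus ?thesis by (rule tendsto_eventually)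
  qed
  have inner_mono: "incseq (\<lambda>n a. ennreal (X a b * cut_kernel \<alpha> (1 / real (Suc n)) (a - b)))" for b
    by (intro monoI le_funI ennreal_leI mult_left_mono mono X0)
  have inner: "(\<lambda>n. \<integral>\<^sup>+a. ennreal (X a b * cut_kernel \<alpha> (1 / real (Suc n)) (a - b)) \<partial>lborel)
     \<longlonglongrightarrow> (\<integral>\<^sup>+a. ennreal (X a b * hyp_kernel \<alpha> (a - b)) \<partial>lborel)" for b
    by (rule nn_integral_LIMSEQ[OF inner_mono]) (measurable, intro tendsto_ennrealI tendsto_mult tendsto_const lim)
  show ?thesis
  proof (rule nn_integral_LIMSEQ[OF _ _ inner])
    show "incseq (\<lambda>n b. \<integral>\<^sup>+a. ennreal (X a b * cut_kernel \<alpha> (1 / real (Suc n)) (a - b)) \<partial>lborel)"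
      by (intro monoI le_funI nn_integral_mono ennreal_leI mult_left_mono mono X0)
  qed measurable
qed

section \<open>The ground state representation\<close>

lemma Beta_constant_pos:
  fixes \<alpha> :: real
  assumes "0 < \<alpha>" "\<alpha> < 2"
  shows "Beta ((1 + \<alpha>) / 2) ((2 - \<alpha>) / 2) > 0"
  unfolding Beta_def
  using assms by (intro divide_pos_pos mult_pos_pos Gamma_real_pos add_pos_pos) simp_all

text \<open>
  Finiteness of the Hardy term is what allows the divergent mass of the truncated kernel to be cancelled
  before the limit is taken; the two energies may be infinite.
\<close>

theorem ground_state_representation:
  fixes \<alpha> :: real and u :: "real \<Rightarrow> real"
  assumes a: "0 < \<alpha>" "\<alpha> < 2" and u[measurable]: "u \<in> borel_measurable borel"
    and u0: "\<And>x. x \<notin> {-1<..<1} \<Longrightarrow> u x = 0"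
    and fin: "(\<integral>\<^sup>+x\<in>{-1<..<1}. ennreal ((u x)\<^sup>2 * (1 - x\<^sup>2) powr (-\<alpha>)) \<partial>lborel) < \<infinity>"
  shows "energy \<alpha> u = weighted_energy \<alpha> u + ennreal (Beta ((1 + \<alpha>) / 2) ((2 - \<alpha>) / 2) / \<alpha>)
     * (\<integral>\<^sup>+x\<in>{-1<..<1}. ennreal ((u x)\<^sup>2 * (1 - x\<^sup>2) powr (-\<alpha>)) \<partial>lborel)"
proof -
  define \<psi> where "\<psi> = profile \<alpha> u"
  have [measurable]: "\<psi> \<in> borel_measurable borel" unfolding \<psi>_def by measurable
  define \<beta> where "\<beta> = Beta ((1 + \<alpha>) / 2) ((2 - \<alpha>) / 2) / \<alpha>"
  have \<beta>: "\<beta> \<ge> 0" using Beta_constant_pos[OF a] a by (simp add: \<beta>_def)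
  define N where "N = (\<integral>\<^sup>+a. ennreal ((\<psi> a)\<^sup>2) \<partial>lborel)"
  have N: "(\<integral>\<^sup>+x\<in>{-1<..<1}. ennreal ((u x)\<^sup>2 * (1 - x\<^sup>2) powr (-\<alpha>)) \<partial>lborel) = N"
    unfolding N_def \<psi>_def by (rule nn_integral_hardy_profile) fact
  have Nfin: "N < top" using fin N by simp
  obtain S err where S: "\<And>n::nat. S n \<ge> (0::real)"
    "\<And>n. (\<integral>\<^sup>+r. ennreal (cut_kernel \<alpha> (1 / real (Suc n)) r) \<partial>lborel) = ennreal (S n)"
    and err: "\<And>n x. \<bar>x\<bar> \<le> 1 \<Longrightarrow>
       \<bar>((cosh (1 / real (Suc n)) / sinh (1 / real (Suc n)) + x) powr \<alpha>
         + (cosh (1 / real (Suc n)) / sinh (1 / real (Suc n)) - x) powr \<alpha>) / \<alpha>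
         - (S n + \<beta>)\<bar> \<le> err n" "err \<longlonglongrightarrow> 0"
    using cut_kernel_asymptotics[OF a] unfolding \<beta>_def by metis
  define P where "P = (\<lambda>n a. ((cosh (1 / real (Suc n)) / sinh (1 / real (Suc n)) + tanh a) powr \<alpha>
         + (cosh (1 / real (Suc n)) / sinh (1 / real (Suc n)) - tanh a) powr \<alpha>) / \<alpha>)"
  have P_meas[measurable]: "P n \<in> borel_measurable borel" for n unfolding P_def by measurable
  have P0: "P n b \<ge> 0" for n b using a by (simp add: P_def)
  have P: "\<bar>P n b - (S n + \<beta>)\<bar> \<le> err n" for n b
    unfolding P_def by (rule err(1)) (use tanh_real_bounds[of b] in auto)
  have err0: "err n \<ge> 0" for n using P[of n 0] by linarith
  define kill where "kill = (\<lambda>a. ((1 + tanh a) powr \<alpha> + (1 - tanh a) powr \<alpha>) / \<alpha>)"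
  have [measurable]: "kill \<in> borel_measurable borel" unfolding kill_def by measurable
  define Ki where "Ki = (\<integral>\<^sup>+a. ennreal ((\<psi> a)\<^sup>2) * ennreal (kill a) \<partial>lborel)"
  define Q where "Q = (\<lambda>n a. \<integral>\<^sup>+r. ennreal (cut_kernel \<alpha> (1 / real (Suc n)) r * (cosh (a + r) / cosh a) powr (\<alpha> - 1)) \<partial>lborel)"
  have [measurable]: "Q n \<in> borel_measurable borel" for n unfolding Q_def by measurable
  have QP: "Q n b + ennreal (kill b) = ennreal (P n b)" for n b
    unfolding Q_def kill_def P_def by (rule nn_integral_cosh_ratio) (use a in auto)
  define X where "X = (\<lambda>a b. (u (tanh a) - u (tanh b))\<^sup>2 * (cosh a * cosh b) powr (\<alpha> - 1))"
  have [measurable]: "case_prod X \<in> borel_measurable (borel \<Otimes>\<^sub>M borel)" unfolding X_def by measurable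
  have X0: "X a b \<ge> 0" for a b by (simp add: X_def)
  \<comment> \<open>\<open>E\<close> and \<open>W\<close> are twice the interior and the weighted energy, \<open>En\<close> and \<open>Wn\<close> their truncations; \<open>Ki\<close> is
    the exterior contribution, and \<open>NP\<close> is the diagonal term completed by it.\<close>
  define E where "E = (\<integral>\<^sup>+b. (\<integral>\<^sup>+a. ennreal (X a b * hyp_kernel \<alpha> (a - b)) \<partial>lborel) \<partial>lborel)"
  define W where "W = (\<integral>\<^sup>+b. (\<integral>\<^sup>+a. ennreal ((\<psi> a - \<psi> b)\<^sup>2 * hyp_kernel \<alpha> (a - b)) \<partial>lborel) \<partial>lborel)"
  define En where "En = (\<lambda>n. \<integral>\<^sup>+b. (\<integral>\<^sup>+a. ennreal (X a b * cut_kernel \<alpha> (1 / real (Suc n)) (a - b)) \<partial>lborel) \<partial>lborel)"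
  define Wn where "Wn = (\<lambda>n. \<integral>\<^sup>+b. (\<integral>\<^sup>+a. ennreal ((\<psi> a - \<psi> b)\<^sup>2 * cut_kernel \<alpha> (1 / real (Suc n)) (a - b)) \<partial>lborel) \<partial>lborel)"
  have En: "En \<longlonglongrightarrow> E" unfolding En_def E_def by (rule cut_kernel_LIMSEQ) (auto simp: X0)
  have Wn: "Wn \<longlonglongrightarrow> W" unfolding Wn_def W_def by (rule cut_kernel_LIMSEQ) auto
  define NP where "NP = (\<lambda>n. \<integral>\<^sup>+a. ennreal ((\<psi> a)\<^sup>2) * ennreal (P n a) \<partial>lborel)"
  have NQ: "(\<integral>\<^sup>+a. ennreal ((\<psi> a)\<^sup>2) * Q n a \<partial>lborel) + Ki = NP n" for n
    unfolding Ki_def NP_def QP[symmetric] distrib_left by (rule nn_integral_add[symmetric]) measurable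
  have Nc: "(\<integral>\<^sup>+a. ennreal ((\<psi> a)\<^sup>2) * c \<partial>lborel) = N * c" for c
    unfolding N_def by (rule nn_integral_multc) measurable
  have id: "En n + 2 * Ki + 2 * (N * ennreal (S n)) = Wn n + 2 * NP n" for n
  proof -
    have "En n + 2 * (\<integral>\<^sup>+a. ennreal ((\<psi> a)\<^sup>2) * ennreal (S n) \<partial>lborel)
      = Wn n + 2 * (\<integral>\<^sup>+a. ennreal ((\<psi> a)\<^sup>2) * Q n a \<partial>lborel)"
      unfolding En_def Wn_def X_def \<psi>_def Q_def S(2)[symmetric]
      by (rule nn_integral_ground_state) auto
    thus ?thesis unfolding Nc NQ[symmetric] by (simp add: distrib_left ac_simps)
  qed
  have NSfin: "2 * (N * ennreal (S n)) \<noteq> top" for n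
    using Nfin by (simp add: ennreal_mult_eq_top_iff)
  \<comment> \<open>Replacing \<open>P n\<close> by \<open>S n + \<beta>\<close> costs at most \<open>err n\<close>; then the finite term with \<open>S n\<close> is cancelled.\<close>
  have le1: "En n + 2 * Ki \<le> Wn n + 2 * (N * ennreal (\<beta> + err n))" for n
  proof -
    have "NP n \<le> (\<integral>\<^sup>+a. ennreal ((\<psi> a)\<^sup>2) * ennreal (S n + (\<beta> + err n)) \<partial>lborel)"
      unfolding NP_def
    proof (intro nn_integral_mono mult_left_mono ennreal_leI)
      fix b show "P n b \<le> S n + (\<beta> + err n)" using P[of n b] by linarith
    qed simp
    also have "\<dots> = N * ennreal (S n) + N * ennreal (\<beta> + err n)"
      unfolding Nc using S(1)[of n] \<beta> err0[of n] by (simp add: distrib_left[symmetric] ennreal_plus[symmetric] del: ennreal_plus)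
    finally have "2 * NP n \<le> 2 * (N * ennreal (S n)) + 2 * (N * ennreal (\<beta> + err n))"
      unfolding distrib_left[symmetric] by (rule mult_left_mono) simp
    hence "2 * (N * ennreal (S n)) + (En n + 2 * Ki) \<le> 2 * (N * ennreal (S n)) + (Wn n + 2 * (N * ennreal (\<beta> + err n)))"
      using id[of n] add_left_mono[of "2 * NP n" _ "Wn n"] by (simp add: ac_simps)
    thus ?thesis using NSfin[of n] by (simp add: ennreal_add_left_cancel_le)
  qed
  have le2: "Wn n + 2 * (N * ennreal \<beta>) \<le> En n + 2 * Ki + 2 * (N * ennreal (err n))" for n
  proof -
    have "N * ennreal (S n) + N * ennreal \<beta> = (\<integral>\<^sup>+a. ennreal ((\<psi> a)\<^sup>2) * ennreal (S n + \<beta>) \<partial>lborel)"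
      unfolding Nc using S(1)[of n] \<beta> by (simp add: distrib_left[symmetric])
    also have "\<dots> \<le> (\<integral>\<^sup>+a. ennreal ((\<psi> a)\<^sup>2) * ennreal (P n a) + ennreal ((\<psi> a)\<^sup>2) * ennreal (err n) \<partial>lborel)"
    proof (intro nn_integral_mono)
      fix b
      have "S n + \<beta> \<le> P n b + err n" using P[of n b] by linarith
      hence "ennreal (S n + \<beta>) \<le> ennreal (P n b) + ennreal (err n)"
        using P0[of n b] err0[of n] by (simp add: ennreal_plus[symmetric] ennreal_leI del: ennreal_plus)
      thus "ennreal ((\<psi> b)\<^sup>2) * ennreal (S n + \<beta>) \<le> ennreal ((\<psi> b)\<^sup>2) * ennreal (P n b) + ennreal ((\<psi> b)\<^sup>2) * ennreal (err n)"
        unfolding distrib_left[symmetric] by (rule mult_left_mono) simp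
    qed
    also have "\<dots> = NP n + N * ennreal (err n)"
      unfolding NP_def Nc[symmetric] by (rule nn_integral_add) measurable
    finally have "2 * (N * ennreal (S n)) + 2 * (N * ennreal \<beta>) \<le> 2 * NP n + 2 * (N * ennreal (err n))"
      unfolding distrib_left[symmetric] by (rule mult_left_mono) simp
    from add_left_mono[OF this, of "Wn n"]
    have "Wn n + (2 * (N * ennreal (S n)) + 2 * (N * ennreal \<beta>)) \<le> (Wn n + 2 * NP n) + 2 * (N * ennreal (err n))"
      by (simp add: ac_simps)
    hence "2 * (N * ennreal (S n)) + (Wn n + 2 * (N * ennreal \<beta>)) \<le> 2 * (N * ennreal (S n)) + (En n + 2 * Ki + 2 * (N * ennreal (err n)))"
      unfolding id[symmetric] by (simp add: ac_simps)
    thus ?thesis using NSfin[of n] by (simp add: ennreal_add_left_cancel_le)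
  qed
  have lim_c: "(\<lambda>n. 2 * (N * ennreal (c + err n))) \<longlonglongrightarrow> 2 * (N * ennreal c)" for c
  proof -
    have "(\<lambda>n. ennreal (c + err n)) \<longlonglongrightarrow> ennreal (c + 0)"
      by (intro tendsto_ennrealI tendsto_add tendsto_const err(2))
    thus ?thesis using Nfin by (intro ennreal_tendsto_cmult) auto
  qed
  have "E + 2 * Ki \<le> W + 2 * (N * ennreal \<beta>)"
    by (rule LIMSEQ_le[OF tendsto_add[OF En tendsto_const] tendsto_add[OF Wn lim_c]]) (use le1 in blast)
  moreover have "W + 2 * (N * ennreal \<beta>) \<le> E + 2 * Ki"
  proof -
    have "(\<lambda>n. En n + 2 * Ki + 2 * (N * ennreal (0 + err n))) \<longlonglongrightarrow> E + 2 * Ki + 2 * (N * ennreal 0)"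
      by (intro tendsto_add En tendsto_const lim_c)
    hence "(\<lambda>n. En n + 2 * Ki + 2 * (N * ennreal (err n))) \<longlonglongrightarrow> E + 2 * Ki" by simp
    thus ?thesis
      by (rule LIMSEQ_le[OF tendsto_add[OF Wn tendsto_const]]) (use le2 in blast)
  qed
  ultimately have main: "E + 2 * Ki = W + 2 * (N * ennreal \<beta>)" by (rule antisym)
  have "energy \<alpha> u = ennreal (1/2) * E + Ki"
  proof -
    note es = energy_split[OF a(1) u, unfolded interior_energy_profile[OF u] nn_integral_killing_profile[OF u a(1)]]
    show ?thesis
      by (subst es) (simp_all add: u0 E_def X_def Ki_def \<psi>_def kill_def)
  qed
  also have "\<dots> = ennreal (1/2) * (E + 2 * Ki)" by (simp only: distrib_left ennreal_half_double)
  also have "\<dots> = ennreal (1/2) * W + ennreal \<beta> * N"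
    unfolding main by (simp only: distrib_left ennreal_half_double mult.commute[of N])
  also have "ennreal (1/2) * W = weighted_energy \<alpha> u"
    unfolding weighted_energy_profile[OF u] W_def \<psi>_def ..
  finally show ?thesis unfolding N \<beta>_def .
qed

section \<open>Continuous functions with compact support\<close>

text \<open>
  Near the endpoints the Hardy weight is unbounded, so what matters is a fixed distance of the support
  from them, together with a bound for the function.
\<close>

lemma Cc_bounded_away:
  assumes "u \<in> Cc"
  obtains \<delta> M where "0 < \<delta>" "\<delta> < 1" "M \<ge> 0" "\<And>x. \<bar>x\<bar> > 1 - \<delta> \<Longrightarrow> u x = 0" "\<And>x. \<bar>u x\<bar> \<le> M"
proof -
  define K where "K = closure {x. u x \<noteq> 0}"
  have K: "compact K" "K \<subseteq> {-1<..<1}" and c: "continuous_on {-1<..<1} u"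
    using assms by (auto simp: Cc_def K_def)
  have uK: "u x = 0" if "x \<notin> K" for x
    using that closure_subset[of "{x. u x \<noteq> 0}"] by (auto simp: K_def)
  have "bounded (u ` K)" using K c by (intro compact_imp_bounded compact_continuous_image continuous_on_subset[OF c])
  then obtain M where M: "\<And>x. x \<in> K \<Longrightarrow> \<bar>u x\<bar> \<le> M" "M > 0"
    by (auto simp: bounded_pos)
  \<comment> \<open>The maximum of \<open>\<bar>x\<bar>\<close> over the support is attained, hence less than \<open>1\<close>.\<close>
  have "\<exists>\<rho><1. \<rho> > 0 \<and> (\<forall>x\<in>K. \<bar>x\<bar> \<le> \<rho>)"
  proof (cases "K = {}")
    case True thus ?thesis by (intro exI[of _ "1/2"]) auto
  next
    case False
    have "continuous_on K (\<lambda>x. \<bar>x\<bar>)" by (intro continuous_intros)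
    then obtain x0 where x0: "x0 \<in> K" "\<And>x. x \<in> K \<Longrightarrow> \<bar>x\<bar> \<le> \<bar>x0\<bar>"
      using continuous_attains_sup[OF K(1) False] by metis
    have "\<bar>x0\<bar> < 1" using subsetD[OF K(2) x0(1)] by (simp add: abs_less_iff)
    thus ?thesis using x0(2) by (intro exI[of _ "(1 + \<bar>x0\<bar>) / 2"]) fastforce
  qed
  then obtain \<rho> where \<rho>: "\<rho> < 1" "\<rho> > 0" "\<And>x. x \<in> K \<Longrightarrow> \<bar>x\<bar> \<le> \<rho>" by blast
  show ?thesis
  proof (rule that[of "1 - \<rho>" M])
    show "u x = 0" if "\<bar>x\<bar> > 1 - (1 - \<rho>)" for x using \<rho>(3)[of x] uK[of x] that by auto
    show "\<bar>u x\<bar> \<le> M" for x using M uK[of x] by (cases "x \<in> K") auto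
  qed (use \<rho> M in auto)
qed

lemma Cc_outside: "u \<in> Cc \<Longrightarrow> x \<notin> {-1<..<1} \<Longrightarrow> u x = 0"
  by (erule Cc_bounded_away) (auto simp: abs_if split: if_splits)

lemma Cc_measurable:
  assumes "u \<in> Cc" shows "u \<in> borel_measurable borel"
proof -
  have "(\<lambda>x. indicator {-1<..<1} x *\<^sub>R u x) \<in> borel_measurable borel"
    using assms by (intro borel_measurable_continuous_on_indicator) (auto simp: Cc_def)
  also have "(\<lambda>x. indicator {-1<..<1} x *\<^sub>R u x) = u"
    using Cc_outside[OF assms] by (auto simp: indicator_def fun_eq_iff)
  finally show ?thesis .
qed

lemma Cc_hardy_finite:
  assumes "u \<in> Cc" "\<alpha> > 0"
  shows "(\<integral>\<^sup>+x\<in>{-1<..<1}. ennreal ((u x)\<^sup>2 * (1 - x\<^sup>2) powr (-\<alpha>)) \<partial>lborel) < \<infinity>"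
proof -
  obtain \<delta> M where d: "0 < \<delta>" "\<delta> < 1" "M \<ge> 0" "\<And>x. \<bar>x\<bar> > 1 - \<delta> \<Longrightarrow> u x = 0" "\<And>x. \<bar>u x\<bar> \<le> M"
    using Cc_bounded_away[OF assms(1)] by metis
  have "(\<integral>\<^sup>+x\<in>{-1<..<1}. ennreal ((u x)\<^sup>2 * (1 - x\<^sup>2) powr (-\<alpha>)) \<partial>lborel)
    \<le> (\<integral>\<^sup>+x\<in>{-1<..<1::real}. ennreal (M\<^sup>2 * \<delta> powr (-\<alpha>)) \<partial>lborel)"
  proof (rule nn_integral_mono)
    fix x
    have "(u x)\<^sup>2 * (1 - x\<^sup>2) powr (-\<alpha>) \<le> M\<^sup>2 * \<delta> powr (-\<alpha>)"
    proof (cases "\<bar>x\<bar> \<le> 1 - \<delta>")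
      case True
      have "(u x)\<^sup>2 \<le> M\<^sup>2" using d(5)[of x] d(3) by (simp add: abs_le_square_iff[symmetric])
      moreover have "x\<^sup>2 \<le> 1 - \<delta>"
      proof -
        have "\<bar>x\<bar> * \<bar>x\<bar> \<le> 1 * \<bar>x\<bar>" using True d by (intro mult_right_mono) auto
        thus ?thesis using True by (simp add: power2_eq_square)
      qed
      hence "(1 - x\<^sup>2) powr (-\<alpha>) \<le> \<delta> powr (-\<alpha>)" using d assms by (intro powr_mono2') auto
      ultimately show ?thesis by (intro mult_mono) auto
    next
      case False thus ?thesis using d(4)[of x] by simp
    qed
    thus "ennreal ((u x)\<^sup>2 * (1 - x\<^sup>2) powr (-\<alpha>)) * indicator {-1<..<1} x
      \<le> ennreal (M\<^sup>2 * \<delta> powr (-\<alpha>)) * indicator {-1<..<1} x"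
      by (intro mult_right_mono ennreal_leI) auto
  qed
  also have "\<dots> < \<infinity>" by (simp add: nn_integral_cmult_indicator ennreal_mult_less_top)
  finally show ?thesis .
qed

section \<open>Tents of vanishing weighted energy\<close>

lemma sinh_ge_self:
  assumes "(r::real) \<ge> 0" shows "r \<le> sinh r"
proof -
  have "sinh 0 - 0 \<le> sinh r - r"
    by (rule DERIV_nonneg_imp_nondecreasing[OF assms])
       (auto intro!: exI derivative_eq_intros simp: cosh_real_ge_1)
  thus ?thesis by simp
qed

lemma sinh_ge_exp:
  assumes "(r::real) \<ge> 1" shows "exp r / 4 \<le> sinh r"
proof -
  have "exp r \<ge> 2" using exp_ge_add_one_self[of r] assms by linarith
  moreover have "exp (-r) \<le> 1" using assms by simp
  ultimately have "exp (-r) * 2 \<le> exp r" by linarith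
  thus ?thesis by (simp add: sinh_field_def field_simps)
qed

text \<open>
  Near \<open>0\<close> the integrand is at most \<open>r powr (1 - \<alpha>)\<close>, which is integrable since \<open>\<alpha> < 2\<close>; for large
  \<open>r\<close>, bounding \<open>r\<^sup>2\<close> by \<open>2 exp r\<close> still leaves the decay \<open>exp (- \<alpha> r)\<close>.
\<close>

lemma hyp_kernel_second_moment_finite:
  fixes \<alpha> :: real
  assumes a: "0 < \<alpha>" "\<alpha> < 2"
  shows "(\<integral>\<^sup>+r. ennreal (r\<^sup>2 * hyp_kernel \<alpha> r) \<partial>lborel) < \<infinity>"
proof -
  define f where "f = (\<lambda>r. r\<^sup>2 * hyp_kernel \<alpha> r)"
  define C where "C = 2 * 4 powr (1 + \<alpha>)"
  have [measurable]: "f \<in> borel_measurable borel" unfolding f_def by measurable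
  have f_even: "f (-r) = f r" for r by (simp add: f_def)
  have f1: "f r \<le> r powr (1 - \<alpha>)" if "0 < r" for r
  proof -
    have "f r = r\<^sup>2 / sinh r powr (1 + \<alpha>)" using that by (simp add: f_def hyp_kernel_def)
    also have "\<dots> \<le> r\<^sup>2 / r powr (1 + \<alpha>)"
      using that a sinh_ge_self[of r] by (intro divide_left_mono powr_mono2 mult_pos_pos) auto
    also have "\<dots> = r powr (1 - \<alpha>)"
      using that powr_diff[of r 2 "1 + \<alpha>"] by (simp add: powr_numeral)
    finally show ?thesis .
  qed
  have f2: "f r \<le> C * exp (-\<alpha> * r)" if "1 \<le> r" for r
  proof -
    have "f r = r\<^sup>2 / sinh r powr (1 + \<alpha>)" using that by (simp add: f_def hyp_kernel_def)
    also have "\<dots> \<le> (2 * exp r) / (exp r / 4) powr (1 + \<alpha>)"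
    proof (intro frac_le powr_mono2)
      show "r\<^sup>2 \<le> 2 * exp r" using exp_lower_Taylor_quadratic[of r] that by simp
    qed (use that a sinh_ge_exp[of r] in auto)
    also have "\<dots> = C * exp (-\<alpha> * r)"
    proof -
      have "(exp r / 4) powr (1 + \<alpha>) = exp r * exp (\<alpha> * r) / 4 powr (1 + \<alpha>)"
        by (simp add: powr_divide exp_powr_real distrib_left exp_add mult.commute)
      thus ?thesis by (simp add: C_def exp_minus field_simps)
    qed
    finally show ?thesis .
  qed
  have I1: "(\<integral>\<^sup>+r. ennreal (r powr (1 - \<alpha>)) * indicator {0..1} r \<partial>lborel) < \<infinity>"
    using nn_integral_has_integral_lebesgue'[OF _ has_integral_powr_from_0[of "1 - \<alpha>" 1]] a by simp
  have I2: "(\<integral>\<^sup>+r. ennreal (C * exp (-\<alpha> * r)) * indicator {1..} r \<partial>lborel) < \<infinity>"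
  proof -
    have "(\<integral>\<^sup>+r. ennreal (C * exp (-\<alpha> * r)) * indicator {1..} r \<partial>lborel)
       = ennreal (0 - (- C * exp (-\<alpha> * 1) / \<alpha>))"
    proof (rule nn_integral_FTC_atLeast)
      show "((\<lambda>r. - C * exp (-\<alpha> * r) / \<alpha>) has_real_derivative C * exp (-\<alpha> * r)) (at r)" for r
        using a by (auto intro!: derivative_eq_intros)
      show "0 \<le> C * exp (-\<alpha> * r)" for r by (simp add: C_def)
      have "filterlim (\<lambda>r. -\<alpha> * r) at_bot at_top"
        using a by (intro filterlim_tendsto_neg_mult_at_bot[OF tendsto_const _ filterlim_ident]) auto
      from tendsto_mult_right_zero[OF filterlim_compose[OF exp_at_bot this], of "- C / \<alpha>"]
      show "((\<lambda>r. - C * exp (-\<alpha> * r) / \<alpha>) \<longlongrightarrow> 0) at_top" by simp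
    qed measurable
    thus ?thesis by simp
  qed
  have half: "(\<integral>\<^sup>+r. ennreal (f r) * indicator {0..} r \<partial>lborel) < \<infinity>"
  proof -
    have "(\<integral>\<^sup>+r. ennreal (f r) * indicator {0..} r \<partial>lborel)
      \<le> (\<integral>\<^sup>+r. ennreal (r powr (1 - \<alpha>)) * indicator {0..1} r + ennreal (C * exp (-\<alpha> * r)) * indicator {1..} r \<partial>lborel)"
    proof (rule nn_integral_mono)
      fix r :: real
      consider "r < 0" | "r = 0" | "0 < r" "r < 1" | "1 \<le> r" by linarith
      thus "ennreal (f r) * indicator {0..} r
        \<le> ennreal (r powr (1 - \<alpha>)) * indicator {0..1} r + ennreal (C * exp (-\<alpha> * r)) * indicator {1..} r"
      proof cases
        case 2 thus ?thesis by (simp add: f_def)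
      next
        case 3 thus ?thesis using f1[of r] by (simp add: ennreal_leI)
      next
        case 4
        hence "ennreal (f r) \<le> ennreal (C * exp (-\<alpha> * r))" using f2 by (intro ennreal_leI) auto
        thus ?thesis using 4 by (simp add: add_increasing)
      qed simp
    qed
    also have "\<dots> = (\<integral>\<^sup>+r. ennreal (r powr (1 - \<alpha>)) * indicator {0..1} r \<partial>lborel)
        + (\<integral>\<^sup>+r. ennreal (C * exp (-\<alpha> * r)) * indicator {1..} r \<partial>lborel)"
      by (rule nn_integral_add) measurable
    also have "\<dots> < \<infinity>" using I1 I2 by simp
    finally show ?thesis .
  qed
  have "(\<integral>\<^sup>+r. ennreal (f r) \<partial>lborel)
     \<le> (\<integral>\<^sup>+r. ennreal (f r) * indicator {0..} r + ennreal (f r) * indicator {..0} r \<partial>lborel)"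
    by (rule nn_integral_mono) (auto simp: indicator_def)
  also have "\<dots> = (\<integral>\<^sup>+r. ennreal (f r) * indicator {0..} r \<partial>lborel) + (\<integral>\<^sup>+r. ennreal (f r) * indicator {..0} r \<partial>lborel)"
    by (rule nn_integral_add) measurable
  also have "(\<integral>\<^sup>+r. ennreal (f r) * indicator {..0} r \<partial>lborel) = (\<integral>\<^sup>+r. ennreal (f r) * indicator {0..} r \<partial>lborel)"
    using nn_integral_real_affine[of "\<lambda>r. ennreal (f r) * indicator {..0} r" "-1" 0]
    by (simp add: indicator_def f_even)
  also have "(\<integral>\<^sup>+r. ennreal (f r) * indicator {0..} r \<partial>lborel) + (\<integral>\<^sup>+r. ennreal (f r) * indicator {0..} r \<partial>lborel) < \<infinity>"
    using half by simp
  finally show ?thesis by (simp add: f_def)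
qed

definition tent :: "real \<Rightarrow> real \<Rightarrow> real" where
  "tent L a = max 0 (1 - \<bar>a\<bar> / L)"

text \<open>
  The function whose profile is the tent of height \<open>1\<close> on \<open>[-L, L]\<close>; in \<open>x\<close>, this is \<open>w\<close> cut off
  logarithmically at the endpoints.
\<close>

definition tent_test :: "real \<Rightarrow> real \<Rightarrow> real \<Rightarrow> real" where
  "tent_test \<alpha> L x = (if x \<in> {-1<..<1} then w \<alpha> x * tent L (artanh x) else 0)"

lemma tent_test_in_Cc:
  assumes "L > 0" shows "tent_test \<alpha> L \<in> Cc"
proof -
  have sq: "1 - x\<^sup>2 > 0" if "x \<in> {-1<..<1}" for x :: real
    using that by (simp add: abs_square_less_1 abs_less_iff)
  have "continuous_on {-1<..<1} (\<lambda>x. w \<alpha> x * tent L (artanh x))"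
    unfolding w_def tent_def using sq assms
    by (intro continuous_intros continuous_on_powr') force+
  hence c: "continuous_on {-1<..<1} (tent_test \<alpha> L)"
    by (rule continuous_on_eq) (simp add: tent_test_def)
  have "{x. tent_test \<alpha> L x \<noteq> 0} \<subseteq> {- tanh L..tanh L}"
  proof
    fix x assume "x \<in> {x. tent_test \<alpha> L x \<noteq> 0}"
    hence x: "-1 < x" "x < 1" and "tent L (artanh x) \<noteq> 0"
      by (auto simp: tent_test_def split: if_splits)
    hence "\<bar>artanh x\<bar> < L" using assms by (auto simp: tent_def max_def field_simps split: if_splits)
    hence "- L \<le> artanh x" "artanh x \<le> L" by auto
    hence "tanh (-L) \<le> tanh (artanh x)" "tanh (artanh x) \<le> tanh L" unfolding tanh_real_le_iff by auto
    thus "x \<in> {- tanh L..tanh L}" using x by (simp add: tanh_artanh)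
  qed
  hence sub: "closure {x. tent_test \<alpha> L x \<noteq> 0} \<subseteq> {- tanh L..tanh L}"
    by (rule closure_minimal) simp
  hence "bounded (closure {x. tent_test \<alpha> L x \<noteq> 0})" by (rule bounded_subset[rotated]) simp
  hence "compact (closure {x. tent_test \<alpha> L x \<noteq> 0})" by (simp add: compact_eq_bounded_closed)
  moreover have "{- tanh L..tanh L} \<subseteq> {-1<..<1}"
    using tanh_real_lt_1[of L] by auto
  ultimately show ?thesis using c sub by (auto simp: Cc_def)
qed

lemma profile_tent_test: "profile \<alpha> (tent_test \<alpha> L) a = tent L a"
  using tanh_real_bounds[of a] by (simp add: profile_eq tent_test_def artanh_tanh_real w_tanh)

lemma tent_Lipschitz:
  assumes "L > 0" shows "\<bar>tent L a - tent L b\<bar> \<le> \<bar>a - b\<bar> / L"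
proof -
  have "\<bar>max 0 (1 - x) - max 0 (1 - y)\<bar> \<le> \<bar>x - y\<bar>" for x y :: real by linarith
  from this[of "\<bar>a\<bar> / L" "\<bar>b\<bar> / L"]
  have "\<bar>tent L a - tent L b\<bar> \<le> \<bar>\<bar>a\<bar> - \<bar>b\<bar>\<bar> / L"
    using assms by (simp add: tent_def diff_divide_distrib[symmetric] abs_divide)
  also have "\<dots> \<le> \<bar>a - b\<bar> / L" using assms by (intro divide_right_mono) auto
  finally show ?thesis .
qed

text \<open>
  The tent has slope \<open>1 / L\<close> and lives on a set of length \<open>2 L\<close>. The difference of two values is nonzero only if
  one of the points lies in that set, so the double integral of \<open>(\<psi> a - \<psi> b)\<^sup>2 k (a - b)\<close> is at most
  \<open>2 * (2 L) * (1 / L\<^sup>2)\<close> times the second moment of \<open>k\<close>.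
\<close>

lemma weighted_energy_tent_test_le:
  assumes L: "L > 0"
  shows "weighted_energy \<alpha> (tent_test \<alpha> L) \<le> ennreal (2 / L) * (\<integral>\<^sup>+r. ennreal (r\<^sup>2 * hyp_kernel \<alpha> r) \<partial>lborel)"
proof -
  define M where "M = (\<integral>\<^sup>+r. ennreal (r\<^sup>2 * hyp_kernel \<alpha> r) \<partial>lborel)"
  define g where "g = (\<lambda>a b. ennreal (1 / L\<^sup>2) * (indicator {-L..L} a * ennreal ((a - b)\<^sup>2 * hyp_kernel \<alpha> (a - b))))"
  have [measurable]: "case_prod g \<in> borel_measurable (borel \<Otimes>\<^sub>M borel)" unfolding g_def by measurable
  have [measurable]: "(\<lambda>a. g a b) \<in> borel_measurable borel" "(\<lambda>a. g b a) \<in> borel_measurable borel" for b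
    unfolding g_def by measurable
  have ev: "hyp_kernel \<alpha> (b - a) = hyp_kernel \<alpha> (a - b)" for a b using hyp_kernel_minus[of \<alpha> "a - b"] by simp
  have pt: "ennreal ((tent L a - tent L b)\<^sup>2 * hyp_kernel \<alpha> (a - b)) \<le> g a b + g b a" for a b
  proof (cases "a \<in> {-L..L} \<or> b \<in> {-L..L}")
    case True
    have "(tent L a - tent L b)\<^sup>2 \<le> (\<bar>a - b\<bar> / L)\<^sup>2"
      using power_mono[OF tent_Lipschitz[OF L, of a b], of 2] by simp
    hence "(tent L a - tent L b)\<^sup>2 * hyp_kernel \<alpha> (a - b) \<le> (\<bar>a - b\<bar> / L)\<^sup>2 * hyp_kernel \<alpha> (a - b)"
      by (rule mult_right_mono) simp
    also have "\<dots> = 1 / L\<^sup>2 * ((a - b)\<^sup>2 * hyp_kernel \<alpha> (a - b))" by (simp add: power_divide)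
    finally have le: "ennreal ((tent L a - tent L b)\<^sup>2 * hyp_kernel \<alpha> (a - b)) \<le> ennreal (1 / L\<^sup>2) * ennreal ((a - b)\<^sup>2 * hyp_kernel \<alpha> (a - b))"
      by (subst ennreal_mult[symmetric]) (auto intro: ennreal_leI)
    show ?thesis
    proof (cases "a \<in> {-L..L}")
      case True
      hence "ennreal ((tent L a - tent L b)\<^sup>2 * hyp_kernel \<alpha> (a - b)) \<le> g a b" using le by (simp add: g_def)
      thus ?thesis by (simp add: add_increasing2)
    next
      case False
      hence "ennreal ((tent L a - tent L b)\<^sup>2 * hyp_kernel \<alpha> (a - b)) \<le> g b a"
      proof -
        have "indicator {-L..L} b = (1::ennreal)" using False True by (intro indicator_simps(1)) blast
        thus ?thesis using le by (simp add: g_def ev power2_commute)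
      qed
      thus ?thesis by (simp add: add_increasing)
    qed
  next
    case False
    hence "L \<le> \<bar>a\<bar>" "L \<le> \<bar>b\<bar>" by auto
    hence "tent L a = 0" "tent L b = 0" using L by (auto simp: tent_def)
    thus ?thesis by simp
  qed
  have inner: "(\<integral>\<^sup>+b. g a b \<partial>lborel) = ennreal (1 / L\<^sup>2) * M * indicator {-L..L} a" for a
  proof -
    have "(\<integral>\<^sup>+b. g a b \<partial>lborel) = (\<integral>\<^sup>+r. ennreal (1 / L\<^sup>2) * (indicator {-L..L} a * ennreal (r\<^sup>2 * hyp_kernel \<alpha> r)) \<partial>lborel)"
      using nn_integral_real_affine[of "\<lambda>b. g a b" 1 a] by (simp add: g_def)
    also have "\<dots> = ennreal (1 / L\<^sup>2) * (indicator {-L..L} a * M)"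
      unfolding M_def by (simp add: nn_integral_cmult)
    finally show ?thesis by (simp add: mult_ac)
  qed
  have one: "(\<integral>\<^sup>+a. (\<integral>\<^sup>+b. g a b \<partial>lborel) \<partial>lborel) = ennreal (2 / L) * M"
  proof -
    have "(\<integral>\<^sup>+a. (\<integral>\<^sup>+b. g a b \<partial>lborel) \<partial>lborel) = ennreal (1 / L\<^sup>2) * M * ennreal (2 * L)"
      unfolding inner using L by (simp add: nn_integral_cmult_indicator)
    also have "\<dots> = ennreal (1 / L\<^sup>2) * ennreal (2 * L) * M" by (simp only: mult_ac)
    also have "ennreal (1 / L\<^sup>2) * ennreal (2 * L) = ennreal (2 / L)"
      using L by (subst ennreal_mult[symmetric]) (auto simp: power2_eq_square)
    finally show ?thesis .
  qed
  have two: "(\<integral>\<^sup>+b. (\<integral>\<^sup>+a. g a b \<partial>lborel) \<partial>lborel) = ennreal (2 / L) * M"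
    by (subst lborel_pair.Fubini') (simp_all add: one)
  have meas: "tent_test \<alpha> L \<in> borel_measurable borel" by (rule Cc_measurable[OF tent_test_in_Cc[OF L]])
  have "weighted_energy \<alpha> (tent_test \<alpha> L) \<le> ennreal (1/2) * (\<integral>\<^sup>+b. (\<integral>\<^sup>+a. g a b + g b a \<partial>lborel) \<partial>lborel)"
    unfolding weighted_energy_profile[OF meas] profile_tent_test
    by (intro mult_left_mono nn_integral_mono pt) simp
  also have "(\<integral>\<^sup>+b. (\<integral>\<^sup>+a. g a b + g b a \<partial>lborel) \<partial>lborel) = 2 * (ennreal (2 / L) * M)"
    by (simp add: nn_integral_add one two mult_2)
  finally show ?thesis by (simp only: ennreal_half_double M_def)
qed

section \<open>Hardy integrals\<close>

lemma hardy_weight_eq: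
  assumes "x \<in> {-1<..<1::real}"
  shows "1 / (x + 1) + 1 / (1 - x) = 2 / (1 - x\<^sup>2)" "1 - x\<^sup>2 > 0"
proof -
  show "1 - x\<^sup>2 > 0" using assms by (simp add: abs_square_less_1 abs_less_iff)
  have "1 - x\<^sup>2 = (x + 1) * (1 - x)" by (simp add: power2_eq_square algebra_simps)
  moreover have "x + 1 \<noteq> 0" "1 - x \<noteq> 0" using assms by auto
  ultimately show "1 / (x + 1) + 1 / (1 - x) = 2 / (1 - x\<^sup>2)" by (simp add: field_simps)
qed

lemma hardy_integral_eq:
  assumes "u \<in> borel_measurable borel"
  shows "hardy_integral \<alpha> u = ennreal (2 powr \<alpha>)
     * (\<integral>\<^sup>+x\<in>{-1<..<1}. ennreal ((u x)\<^sup>2 * (1 - x\<^sup>2) powr (-\<alpha>)) \<partial>lborel)"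
proof -
  note [measurable] = assms
  have "hardy_integral \<alpha> u = (\<integral>\<^sup>+x. ennreal (2 powr \<alpha>) * (ennreal ((u x)\<^sup>2 * (1 - x\<^sup>2) powr (-\<alpha>)) * indicator {-1<..<1} x) \<partial>lborel)"
    unfolding hardy_integral_def
  proof (rule nn_integral_cong)
    fix x :: real
    show "ennreal ((u x)\<^sup>2 * (1 / (x + 1) + 1 / (1 - x)) powr \<alpha>) * indicator {-1<..<1} x
       = ennreal (2 powr \<alpha>) * (ennreal ((u x)\<^sup>2 * (1 - x\<^sup>2) powr (-\<alpha>)) * indicator {-1<..<1} x)"
    proof (cases "x \<in> {-1<..<1}")
      case True
      have "(u x)\<^sup>2 * (1 / (x + 1) + 1 / (1 - x)) powr \<alpha> = 2 powr \<alpha> * ((u x)\<^sup>2 * (1 - x\<^sup>2) powr (-\<alpha>))"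
        unfolding hardy_weight_eq(1)[OF True] using hardy_weight_eq(2)[OF True]
        by (simp add: powr_divide powr_minus field_simps)
      hence "ennreal ((u x)\<^sup>2 * (1 / (x + 1) + 1 / (1 - x)) powr \<alpha>)
         = ennreal (2 powr \<alpha>) * ennreal ((u x)\<^sup>2 * (1 - x\<^sup>2) powr (-\<alpha>))"
        by (simp only:) (rule ennreal_mult, simp_all)
      thus ?thesis using True by (simp only: indicator_simps mult_1_right)
    qed simp
  qed
  also have "\<dots> = ennreal (2 powr \<alpha>) * (\<integral>\<^sup>+x\<in>{-1<..<1}. ennreal ((u x)\<^sup>2 * (1 - x\<^sup>2) powr (-\<alpha>)) \<partial>lborel)"
    by (rule nn_integral_cmult) measurable
  finally show ?thesis .
qed

text \<open>
  The weight \<open>1 / (x + 1) + 1 / (1 - x)\<close> is at least \<open>2\<close>. Hence an improved constant would be a special case of a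
  remainder term.
\<close>

lemma hardy_integral_lower_power:
  assumes [measurable]: "u \<in> borel_measurable borel"
  shows "ennreal 2 * hardy_integral (\<alpha> - 1) u \<le> hardy_integral \<alpha> u"
proof -
  have "ennreal 2 * hardy_integral (\<alpha> - 1) u
     = (\<integral>\<^sup>+x. ennreal 2 * (ennreal ((u x)\<^sup>2 * (1 / (x + 1) + 1 / (1 - x)) powr (\<alpha> - 1)) * indicator {-1<..<1} x) \<partial>lborel)"
    unfolding hardy_integral_def by (rule nn_integral_cmult[symmetric]) measurable
  also have "\<dots> \<le> hardy_integral \<alpha> u" unfolding hardy_integral_def
  proof (rule nn_integral_mono)
    fix x :: real
    show "ennreal 2 * (ennreal ((u x)\<^sup>2 * (1 / (x + 1) + 1 / (1 - x)) powr (\<alpha> - 1)) * indicator {-1<..<1} x)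
      \<le> ennreal ((u x)\<^sup>2 * (1 / (x + 1) + 1 / (1 - x)) powr \<alpha>) * indicator {-1<..<1} x"
    proof (cases "x \<in> {-1<..<1}")
      case True
      define t where "t = 1 / (x + 1) + 1 / (1 - x)"
      have t: "t \<ge> 2" unfolding t_def hardy_weight_eq(1)[OF True]
        using hardy_weight_eq(2)[OF True] by (simp add: le_divide_eq)
      have "2 * t powr (\<alpha> - 1) \<le> t * t powr (\<alpha> - 1)" using t by (intro mult_right_mono) auto
      also have "\<dots> = t powr \<alpha>" using t powr_mult_base[of t "\<alpha> - 1"] by simp
      finally have "(u x)\<^sup>2 * (2 * t powr (\<alpha> - 1)) \<le> (u x)\<^sup>2 * t powr \<alpha>" by (rule mult_left_mono) simp
      hence "ennreal (2 * ((u x)\<^sup>2 * t powr (\<alpha> - 1))) \<le> ennreal ((u x)\<^sup>2 * t powr \<alpha>)"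
        by (intro ennreal_leI) (simp add: mult_ac)
      hence "ennreal 2 * ennreal ((u x)\<^sup>2 * t powr (\<alpha> - 1)) \<le> ennreal ((u x)\<^sup>2 * t powr \<alpha>)"
        by (simp add: ennreal_mult')
      thus ?thesis using True by (simp add: t_def)
    qed simp
  qed
  finally show ?thesis .
qed

text \<open>
  On \<open>[- tanh 1, tanh 1]\<close> the tent is at least \<open>1/2\<close> as soon as \<open>L \<ge> 2\<close>, and the weights cancel.
\<close>

lemma hardy_integral_tent_test_ge:
  assumes L: "L \<ge> 2"
  shows "hardy_integral (\<alpha> - 1) (tent_test \<alpha> L) \<ge> ennreal (2 powr (\<alpha> - 1) / 4 * (2 * tanh 1))"
proof -
  have "ennreal (2 powr (\<alpha> - 1) / 4 * (2 * tanh 1)) = (\<integral>\<^sup>+x\<in>{- tanh 1..tanh 1 :: real}. ennreal (2 powr (\<alpha> - 1) / 4) \<partial>lborel)"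
  proof -
    have const: "(\<integral>\<^sup>+x\<in>{-t..t}. ennreal c \<partial>lborel) = ennreal (c * (2 * t))" if "t \<ge> 0" "c \<ge> 0" for t c :: real
      using that by (simp add: nn_integral_cmult_indicator ennreal_mult)
    show ?thesis by (rule sym, rule const) simp_all
  qed
  also have "\<dots> \<le> hardy_integral (\<alpha> - 1) (tent_test \<alpha> L)"
    unfolding hardy_integral_def
  proof (rule nn_integral_mono)
    fix x :: real
    show "ennreal (2 powr (\<alpha> - 1) / 4) * indicator {- tanh 1..tanh 1} x
      \<le> ennreal ((tent_test \<alpha> L x)\<^sup>2 * (1 / (x + 1) + 1 / (1 - x)) powr (\<alpha> - 1)) * indicator {-1<..<1} x"
    proof (cases "x \<in> {- tanh 1..tanh 1}")
      case True
      hence x: "x \<in> {-1<..<1}" using tanh_real_lt_1[of 1] by auto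
      define b where "b = artanh x"
      have xb: "x = tanh b" using x by (simp add: b_def tanh_artanh)
      have "tanh (-1) \<le> tanh b" "tanh b \<le> tanh 1" using True by (auto simp: xb)
      hence "\<bar>b\<bar> \<le> 1" unfolding tanh_real_le_iff by auto
      hence "\<bar>b\<bar> / L \<le> 1 / 2" using L by (intro frac_le) auto
      hence "tent L b \<ge> 1 / 2" unfolding tent_def by linarith
      hence tt: "(tent L b)\<^sup>2 \<ge> 1 / 4" using power_mono[of "1/2" "tent L b" 2] by (simp add: power2_eq_square)
      have pos: "1 - x\<^sup>2 > 0" by (rule hardy_weight_eq(2)[OF x])
      have w2: "(w \<alpha> x)\<^sup>2 = (1 - x\<^sup>2) powr (\<alpha> - 1)"
        using pos by (simp add: w_def powr_power diff_divide_distrib)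
      have "(tent_test \<alpha> L x)\<^sup>2 * (1 / (x + 1) + 1 / (1 - x)) powr (\<alpha> - 1) = 2 powr (\<alpha> - 1) * (tent L b)\<^sup>2"
        unfolding hardy_weight_eq(1)[OF x] using x pos
        by (simp add: tent_test_def power_mult_distrib w2 powr_divide b_def)
      moreover have "2 powr (\<alpha> - 1) * (1 / 4) \<le> 2 powr (\<alpha> - 1) * (tent L b)\<^sup>2"
        using tt by (intro mult_left_mono) auto
      ultimately show ?thesis using True x by (simp add: ennreal_leI)
    qed simp
  qed
  finally show ?thesis .
qed

section \<open>The sharp Hardy inequality\<close>

theorem corollary4:
  fixes \<alpha> :: real
  assumes "0 < \<alpha>" and "\<alpha> < 2"
  shows "(\<forall>u\<in>Cc.
            energy \<alpha> u = weighted_energy \<alpha> u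
              + ennreal (Beta ((1 + \<alpha>) / 2) ((2 - \<alpha>) / 2) / \<alpha>)
                * (\<integral>\<^sup>+ x\<in>{-1<..<1}. ennreal ((u x)\<^sup>2 * (1 - x\<^sup>2) powr (- \<alpha>)) \<partial>lborel)
          \<and> weighted_energy \<alpha> u
              + ennreal (Beta ((1 + \<alpha>) / 2) ((2 - \<alpha>) / 2) / \<alpha>)
                * (\<integral>\<^sup>+ x\<in>{-1<..<1}. ennreal ((u x)\<^sup>2 * (1 - x\<^sup>2) powr (- \<alpha>)) \<partial>lborel)
            \<ge> ennreal (Beta ((1 + \<alpha>) / 2) ((2 - \<alpha>) / 2) / (\<alpha> * 2 powr \<alpha>)) * hardy_integral \<alpha> u)
       \<and> (\<forall>C::real. C > Beta ((1 + \<alpha>) / 2) ((2 - \<alpha>) / 2) / (\<alpha> * 2 powr \<alpha>) \<longrightarrow>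
            \<not> (\<forall>u\<in>Cc. energy \<alpha> u \<ge> ennreal C * hardy_integral \<alpha> u))
       \<and> \<not> (\<exists>c::real. c > 0 \<and>
            (\<forall>u\<in>Cc. energy \<alpha> u
               \<ge> ennreal (Beta ((1 + \<alpha>) / 2) ((2 - \<alpha>) / 2) / (\<alpha> * 2 powr \<alpha>)) * hardy_integral \<alpha> u
                 + ennreal c * hardy_integral (\<alpha> - 1) u))"
proof -
  define \<beta> where "\<beta> = Beta ((1 + \<alpha>) / 2) ((2 - \<alpha>) / 2) / \<alpha>"
  define \<kappa> where "\<kappa> = Beta ((1 + \<alpha>) / 2) ((2 - \<alpha>) / 2) / (\<alpha> * 2 powr \<alpha>)"
  define N where "N = (\<lambda>u. \<integral>\<^sup>+ x\<in>{-1<..<1}. ennreal ((u x)\<^sup>2 * (1 - x\<^sup>2) powr (- \<alpha>)) \<partial>lborel)"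
  have \<beta>: "\<beta> > 0" and \<kappa>: "\<kappa> > 0" using Beta_constant_pos[OF assms] assms by (simp_all add: \<beta>_def \<kappa>_def)
  have eq: "energy \<alpha> u = weighted_energy \<alpha> u + ennreal \<beta> * N u" if "u \<in> Cc" for u
    unfolding \<beta>_def N_def
    by (rule ground_state_representation[OF assms Cc_measurable[OF that] Cc_outside[OF that] Cc_hardy_finite[OF that assms(1)]])
  have hardy: "ennreal \<kappa> * hardy_integral \<alpha> u = ennreal \<beta> * N u" if "u \<in> Cc" for u
  proof -
    have "ennreal \<kappa> * ennreal (2 powr \<alpha>) = ennreal \<beta>"
      using \<kappa> by (subst ennreal_mult[symmetric]) (auto simp: \<kappa>_def \<beta>_def)
    thus ?thesis unfolding hardy_integral_eq[OF Cc_measurable[OF that]] N_def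
      by (simp only: mult.assoc[symmetric])
  qed
  have Nfin: "ennreal \<beta> * N u \<noteq> top" if "u \<in> Cc" for u
    using Cc_hardy_finite[OF that assms(1)] by (simp add: N_def ennreal_mult_eq_top_iff)
  have no_remainder: "\<not> (\<forall>u\<in>Cc. energy \<alpha> u \<ge> ennreal \<kappa> * hardy_integral \<alpha> u + ennreal c * hardy_integral (\<alpha> - 1) u)"
    if c: "c > 0" for c
  proof
    assume *: "\<forall>u\<in>Cc. energy \<alpha> u \<ge> ennreal \<kappa> * hardy_integral \<alpha> u + ennreal c * hardy_integral (\<alpha> - 1) u"
    define h :: real where "h = 2 powr (\<alpha> - 1) / 4 * (2 * tanh 1)"
    have h: "h > 0" by (simp add: h_def)
    obtain M where M: "(\<integral>\<^sup>+r. ennreal (r\<^sup>2 * hyp_kernel \<alpha> r) \<partial>lborel) = ennreal M" "M \<ge> 0"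
      using hyp_kernel_second_moment_finite[OF assms] by (auto simp: less_top_ennreal)
    \<comment> \<open>The second summand makes the bound \<open>2 M / L\<close> for the weighted energy smaller than \<open>c h\<close>, a lower bound
      for the remainder.\<close>
    define L where "L = 2 + 2 * M / (c * h)"
    have L: "L \<ge> 2" using M c h by (simp add: L_def)
    define u where "u = tent_test \<alpha> L"
    have u: "u \<in> Cc" unfolding u_def using L by (intro tent_test_in_Cc) auto
    have "ennreal \<beta> * N u + ennreal c * hardy_integral (\<alpha> - 1) u \<le> ennreal \<beta> * N u + weighted_energy \<alpha> u"
      using bspec[OF * u] unfolding hardy[OF u] eq[OF u] by (simp add: add.commute)
    hence "ennreal c * hardy_integral (\<alpha> - 1) u \<le> weighted_energy \<alpha> u"
      using Nfin[OF u] by (simp add: ennreal_add_left_cancel_le)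
    also have "\<dots> \<le> ennreal (2 / L) * ennreal M"
      unfolding u_def M(1)[symmetric] by (rule weighted_energy_tent_test_le) (use L in auto)
    also have "\<dots> = ennreal (2 * M / L)" using M(2) L by (simp add: ennreal_mult'[symmetric])
    finally have "ennreal c * hardy_integral (\<alpha> - 1) u \<le> ennreal (2 * M / L)" .
    moreover have "ennreal (c * h) \<le> ennreal c * hardy_integral (\<alpha> - 1) u"
      unfolding u_def h_def using hardy_integral_tent_test_ge[OF L, of \<alpha>] c
      by (subst ennreal_mult) (auto intro!: mult_left_mono)
    ultimately have "ennreal (c * h) \<le> ennreal (2 * M / L)" by (rule order_trans[rotated])
    hence "c * h \<le> 2 * M / L" using M(2) L by (subst (asm) ennreal_le_iff) auto
    hence "c * h * L \<le> 2 * M" using L by (simp add: pos_le_divide_eq)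
    moreover have "c * h * L = 2 * (c * h) + 2 * M" using c h by (simp add: L_def field_simps)
    ultimately show False using mult_pos_pos[OF c h] by linarith
  qed
  have sharp: "\<not> (\<forall>u\<in>Cc. energy \<alpha> u \<ge> ennreal C * hardy_integral \<alpha> u)" if C: "C > \<kappa>" for C
  proof
    assume *: "\<forall>u\<in>Cc. energy \<alpha> u \<ge> ennreal C * hardy_integral \<alpha> u"
    have "energy \<alpha> u \<ge> ennreal \<kappa> * hardy_integral \<alpha> u + ennreal (2 * (C - \<kappa>)) * hardy_integral (\<alpha> - 1) u" if u: "u \<in> Cc" for u
    proof -
      have "ennreal (2 * (C - \<kappa>)) * hardy_integral (\<alpha> - 1) u = ennreal (C - \<kappa>) * (ennreal 2 * hardy_integral (\<alpha> - 1) u)"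
      proof -
        have "ennreal (2 * (C - \<kappa>)) = ennreal (C - \<kappa>) * ennreal 2"
          using C by (subst mult.commute, intro ennreal_mult) auto
        thus ?thesis by (simp only: mult.assoc)
      qed
      also have "\<dots> \<le> ennreal (C - \<kappa>) * hardy_integral \<alpha> u"
        by (intro mult_left_mono hardy_integral_lower_power Cc_measurable[OF u]) simp
      finally have "ennreal \<kappa> * hardy_integral \<alpha> u + ennreal (2 * (C - \<kappa>)) * hardy_integral (\<alpha> - 1) u
        \<le> (ennreal \<kappa> + ennreal (C - \<kappa>)) * hardy_integral \<alpha> u"
        unfolding distrib_right by (rule add_left_mono)
      also have "ennreal \<kappa> + ennreal (C - \<kappa>) = ennreal C"
        using C \<kappa> by (subst ennreal_plus[symmetric]) auto
      also have "ennreal C * hardy_integral \<alpha> u \<le> energy \<alpha> u" using * u by blast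
      finally show ?thesis .
    qed
    thus False using no_remainder[of "2 * (C - \<kappa>)"] C by auto
  qed
  have N_fold: "(\<integral>\<^sup>+ x\<in>{-1<..<1}. ennreal ((u x)\<^sup>2 * (1 - x\<^sup>2) powr (- \<alpha>)) \<partial>lborel) = N u" for u
    by (simp add: N_def)
  show ?thesis
    unfolding \<beta>_def[symmetric] \<kappa>_def[symmetric] N_fold
  proof (intro conjI ballI allI impI)
    fix u assume u: "u \<in> Cc"
    show "energy \<alpha> u = weighted_energy \<alpha> u + ennreal \<beta> * N u" by (rule eq[OF u])
    show "ennreal \<kappa> * hardy_integral \<alpha> u \<le> weighted_energy \<alpha> u + ennreal \<beta> * N u"
      unfolding hardy[OF u] by (simp add: add_increasing)
  qed (use sharp no_remainder in auto)
qed

end
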